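(* For the complete graph $K_n$ with i.i.d. exponential passage times of parameter $1$ on its edges, let $\tau_{\mathrm{flood}}^{(K_n)}=\max_{v\in V}\tau_{\mathrm{flood}}^{v}$ be the maximum of the flooding times over all sources $v$. Then, as $n\to\infty$, $$\mathbb{E}\left[\tau_{\mathrm{flood}}^{(K_n)}\right]\sim\frac{3}{n}\ln n ,$$ that is, the ratio of the two sides tends to $1$.
   Context: First-passage percolation on a finite connected graph $G=(V,E)$: let $(T_e)_{e\in E}$ be i.i.d. exponential random variables with parameter $1$ ($T_e$ is the passage time of edge $e$). The passage time of a path is the sum of the passage times of its edges, and the passage time $\mathcal{L}(a,b)$ from site $a$ to site $b$ is the minimum of the passage times of all paths from $a$ to $b$. The flooding time from the source $v$ is $\tau_{\mathrm{flood}}^{v}=\sup_{u\in V}\mathcal{L}(v,u)$. *)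

theory Defs
  imports
    "HOL-Probability.Probability"
    "HOL-Library.Landau_Symbols"
    "Graph_Theory.Graph_Theory"
begin

text \<open>
  Undirected graphs are symmetric digraphs, as in \<^theory>\<open>Graph_Theory.Digraph\<close>. A passage time
  belongs to the undirected edge \<open>{a, b}\<close>, so it is shared by the two arcs \<open>(a, b)\<close> and \<open>(b, a)\<close>.
\<close>

definition arc_edge :: "('v, 'b) pre_digraph \<Rightarrow> 'b \<Rightarrow> 'v set" where
  "arc_edge G e = {tail G e, head G e}"

definition edges :: "('v, 'b) pre_digraph \<Rightarrow> 'v set set" where
  "edges G = arc_edge G ` arcs G"

definition path_passage_time :: "('v, 'b) pre_digraph \<Rightarrow> ('v set \<Rightarrow> real) \<Rightarrow> 'b awalk \<Rightarrow> real" where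
  "path_passage_time G t p = (\<Sum>e\<leftarrow>p. t (arc_edge G e))"

text \<open>
  Paths do not repeat vertices, so the minimum ranges over a finite set, which is nonempty if
  \<open>G\<close> is connected. The empty path gives \<open>passage_time G t a a = 0\<close>.
\<close>

definition passage_time :: "('v, 'b) pre_digraph \<Rightarrow> ('v set \<Rightarrow> real) \<Rightarrow> 'v \<Rightarrow> 'v \<Rightarrow> real" where
  "passage_time G t a b = Min (path_passage_time G t ` {p. pre_digraph.apath G a p b})"

definition flooding_time_from :: "('v, 'b) pre_digraph \<Rightarrow> ('v set \<Rightarrow> real) \<Rightarrow> 'v \<Rightarrow> real" where
  "flooding_time_from G t v = (SUP u\<in>verts G. passage_time G t v u)"

definition max_flooding_time :: "('v, 'b) pre_digraph \<Rightarrow> ('v set \<Rightarrow> real) \<Rightarrow> real" where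
  "max_flooding_time G t = Max (flooding_time_from G t ` verts G)"

definition complete_graph :: "nat \<Rightarrow> (nat, nat \<times> nat) pre_digraph" where
  "complete_graph n =
     with_proj \<lparr> pverts = {..<n}, parcs = {(u, v). u \<in> {..<n} \<and> v \<in> {..<n} \<and> u \<noteq> v} \<rparr>"

lemma complete_digraph_complete_graph: "complete_digraph n (complete_graph n)"
  unfolding complete_graph_def by (subst complete_digraph_pair_def) auto

lemma edges_complete_graph:
  "edges (complete_graph n) = {e. e \<subseteq> {..<n} \<and> card e = 2}"
  by (fastforce simp: edges_def arc_edge_def complete_graph_def image_iff card_2_iff)

end

theory Submission
  imports Defs "HOL-Real_Asymp.Real_Asymp"
begin

text \<open>
  The constant 3 splits as 1 + 2. Flooding the graph from a fixed source takes about
  \<open>2 * ln n / n\<close>: with \<open>k\<close> wet vertices, the next one is reached across the fastest of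
  \<open>k * (n - k)\<close> edges, after an exponential time of parameter \<open>k * (n - k)\<close>, and the sum of
  \<open>1 / (k * (n - k))\<close> is about \<open>2 * ln n / n\<close>. One of these \<open>ln n / n\<close> is spent on reaching a typical
  vertex and the other one on reaching the most isolated vertex. The maximum over all sources adds
  another \<open>ln n / n\<close>, because the worst source is as isolated as the worst target.

  Upper bound. The exploration is made precise by \<open>flooding_time_from_set_step\<close>, a deterministic
  comparison: the flooding time from a set \<open>A\<close> is at most the smallest passage time \<open>m\<close> across the boundary of
  \<open>A\<close> plus the flooding time from \<open>A\<close> and the newly reached vertex, where \<open>m\<close> is subtracted from all
  boundary edges. By memorylessness (\<open>exponential_family_min\<close>) the residual passage times are as good as
  new, so exponential moments multiply (\<open>exp_moment_flooding_step\<close>), and for \<open>\<theta> < n - 1\<close> the moment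
  of order \<open>\<theta>\<close> of the maximal flooding time is at most \<open>n\<close> times the product of
  \<open>k * (n - k) / (k * (n - k) - \<theta>)\<close> over \<open>k < n\<close>. For \<open>\<theta> = (1 - \<delta>) * (n - 1)\<close> the logarithm of this bound is
  at most \<open>3 * ln n + 2 + 8 / \<delta>\<close> (\<open>exp_moment_product_bound\<close>), and Jensen's inequality bounds the expectation
  by this logarithm divided by \<open>\<theta>\<close>.

  Lower bound. Let \<open>a\<close> be slightly less than \<open>ln n / n\<close> and call a vertex isolated if all its edges have
  passage time at least \<open>a\<close>. By the second-moment method there are at least two isolated vertices with
  high probability (\<open>prob_at_most_one_event\<close>). A path between two isolated vertices pays \<open>a\<close> at both ends and,
  by memorylessness, otherwise behaves like a path between typical vertices. A first-moment
  bound over all paths (\<open>prob_short_path_complete_graph\<close>) shows that the latter takes at least some \<open>b\<close> slightly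
  less than \<open>ln n / n\<close>, up to a probability that is small even compared with the inverse of the expected number of
  isolated pairs. Hence the maximal flooding time is at least \<open>2 * a + b\<close> with high probability.
\<close>

section \<open>Passage times and potentials\<close>

lemma path_passage_time_Nil [simp]: "path_passage_time G t [] = 0"
  by (simp add: path_passage_time_def)

lemma path_passage_time_Cons [simp]:
  "path_passage_time G t (e # p) = t (arc_edge G e) + path_passage_time G t p"
  by (simp add: path_passage_time_def)

lemma path_passage_time_append [simp]:
  "path_passage_time G t (p @ q) = path_passage_time G t p + path_passage_time G t q"
  by (simp add: path_passage_time_def)

lemma arc_edge_in_edges [intro]: "e \<in> arcs G \<Longrightarrow> arc_edge G e \<in> edges G"
  by (simp add: edges_def)

lemma path_passage_time_mono:
  assumes "set p \<subseteq> arcs G" "\<And>e. e \<in> edges G \<Longrightarrow> t e \<le> t' e"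
  shows "path_passage_time G t p \<le> path_passage_time G t' p"
  using assms(1) by (induction p) (auto intro!: add_mono assms(2))

text \<open>
  The exploration of the graph from a source reaches larger and larger sets of vertices. Its state is
  described by the time needed to flood the graph when a whole set \<open>A\<close> is wet at time 0.
\<close>

definition passage_time_from_set ::
    "('v, 'b) pre_digraph \<Rightarrow> ('v set \<Rightarrow> real) \<Rightarrow> 'v set \<Rightarrow> 'v \<Rightarrow> real" where
  "passage_time_from_set G t A u = Min ((\<lambda>a. passage_time G t a u) ` A)"

definition flooding_time_from_set ::
    "('v, 'b) pre_digraph \<Rightarrow> ('v set \<Rightarrow> real) \<Rightarrow> 'v set \<Rightarrow> real" where
  "flooding_time_from_set G t A = Max (passage_time_from_set G t A ` verts G)"

definition edge_boundary :: "('v, 'b) pre_digraph \<Rightarrow> 'v set \<Rightarrow> 'v set set" where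
  "edge_boundary G A = arc_edge G ` {e \<in> arcs G. tail G e \<in> A \<and> head G e \<notin> A}"

context fin_digraph
begin

lemma finite_edges [simp]: "finite (edges G)"
  by (simp add: edges_def)

lemma edge_boundary_subset: "edge_boundary G A \<subseteq> edges G"
  by (auto simp: edge_boundary_def)

lemma passage_time_le_path: "apath a p u \<Longrightarrow> passage_time G t a u \<le> path_passage_time G t p"
  unfolding passage_time_def by (rule Min_le) (auto intro: apaths_finite)

lemma passage_time_attained:
  assumes "a \<rightarrow>\<^sup>* u"
  obtains p where "apath a p u" "passage_time G t a u = path_passage_time G t p"
proof -
  have "passage_time G t a u \<in> path_passage_time G t ` {p. apath a p u}"
    unfolding passage_time_def using assms by (intro Min_in) (auto intro: apaths_finite simp: reachable_apath)
  thus ?thesis using that by auto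
qed

lemma passage_time_refl_le: "a \<in> verts G \<Longrightarrow> passage_time G t a a \<le> 0"
  using passage_time_le_path[of a "[]" a t] by (simp add: apath_Nil_iff)

lemma passage_time_mono:
  assumes "a \<rightarrow>\<^sup>* u" "\<And>e. e \<in> edges G \<Longrightarrow> t e \<le> t' e"
  shows "passage_time G t a u \<le> passage_time G t' a u"
proof -
  obtain p where p: "apath a p u" "passage_time G t' a u = path_passage_time G t' p"
    using passage_time_attained[OF assms(1)] .
  have "path_passage_time G t p \<le> path_passage_time G t' p"
    using p(1) assms(2) by (intro path_passage_time_mono) (auto simp: apath_def)
  thus ?thesis using passage_time_le_path[OF p(1), of t] p(2) by simp
qed

text \<open>
  A fastest path to the tail of \<open>e\<close>, followed by \<open>e\<close>, leads to its head. If the head lies on the path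
  already, this is not a path, but then an initial segment is one and is no slower.
\<close>

lemma passage_time_step:
  assumes nonneg: "\<And>e. e \<in> edges G \<Longrightarrow> 0 \<le> t e"
    and e: "e \<in> arcs G" and "a \<rightarrow>\<^sup>* tail G e"
  shows "passage_time G t a (head G e) \<le> passage_time G t a (tail G e) + t (arc_edge G e)"
proof -
  obtain p where p: "apath a p (tail G e)"
      "passage_time G t a (tail G e) = path_passage_time G t p"
    using passage_time_attained[OF assms(3)] .
  have arcs: "set p \<subseteq> arcs G"
    using p(1) by (auto simp: apath_def)
  show ?thesis
  proof (cases "head G e \<in> set (awalk_verts a p)")
    case True
    then obtain q r where qr: "p = q @ r" "awalk a q (head G e)"
      using awalk_decomp[of a p "tail G e" "head G e"] p(1) by (auto simp: apath_def)
    have "apath a q (head G e)"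
      using p(1) qr apath_append_iff[of a q r "tail G e"] awalk_ends_eqD by (auto simp: awalkI_apath)
    moreover have "path_passage_time G (\<lambda>_. 0) r \<le> path_passage_time G t r"
      using arcs qr by (intro path_passage_time_mono nonneg) auto
    hence "0 \<le> path_passage_time G t r"
      by (simp add: path_passage_time_def)
    moreover have "0 \<le> t (arc_edge G e)" using e by (auto intro: nonneg)
    ultimately show ?thesis using passage_time_le_path[of a q "head G e" t] p(2) qr(1) by simp
  next
    case False
    moreover have "tail G e \<noteq> head G e"
      using False p(1) awalk_verts_arc2 
      by (metis apath_def awalkE awalk_verts_non_Nil last_in_set)
    ultimately have "apath a (p @ [e]) (head G e)"
      using p(1) e awlast_of_awalk[OF awalkI_apath[OF p(1)]]
      by (auto simp: apath_append_iff apath_Cons_iff apath_Nil_iff)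
    from passage_time_le_path[OF this, of t] show ?thesis using p(2) by simp
  qed
qed

text \<open>
  A potential \<open>h\<close> is a function on vertices that grows along an arc by at most the passage time of the
  arc, so it grows along a path by at most the passage time of the path. Passage times are the
  largest potentials that vanish at the sources. This duality compares passage times under two
  different weightings without any surgery on paths.
\<close>

lemma potential_le_path:
  assumes "\<And>e. e \<in> arcs G \<Longrightarrow> h (head G e) \<le> h (tail G e) + t (arc_edge G e)"
    and "awalk a p u"
  shows "h u \<le> h a + path_passage_time G t p"
  using assms(2)
proof (induction p arbitrary: a)
  case (Cons e p)
  hence "h u \<le> h (head G e) + path_passage_time G t p" and "e \<in> arcs G" "tail G e = a"
    by (auto simp: awalk_Cons_iff)
  thus ?case using assms(1)[of e] by simp
qed (simp add: awalk_Nil_iff)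

end

locale strongly_connected_digraph = fin_digraph +
  assumes strongly_connected: "strongly_connected G"
begin

lemma reach: "u \<in> verts G \<Longrightarrow> v \<in> verts G \<Longrightarrow> u \<rightarrow>\<^sup>* v"
  using strongly_connected by (auto simp: strongly_connected_def)

lemma verts_nonempty: "verts G \<noteq> {}"
  using strongly_connected by (auto simp: strongly_connected_def)

lemma finite_sources: "A \<subseteq> verts G \<Longrightarrow> finite A"
  by (rule finite_subset) auto

lemma passage_time_from_set_le:
  "A \<subseteq> verts G \<Longrightarrow> a \<in> A \<Longrightarrow> passage_time_from_set G t A u \<le> passage_time G t a u"
  unfolding passage_time_from_set_def by (rule Min_le) (auto dest: finite_sources)

lemma passage_time_from_set_attained:
  assumes "A \<subseteq> verts G" "A \<noteq> {}"
  obtains a where "a \<in> A" "passage_time_from_set G t A u = passage_time G t a u"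
proof -
  have "passage_time_from_set G t A u \<in> (\<lambda>a. passage_time G t a u) ` A"
    unfolding passage_time_from_set_def using assms by (intro Min_in) (auto dest: finite_sources)
  thus ?thesis using that by auto
qed

lemma passage_time_from_set_source_le:
  assumes "A \<subseteq> verts G" "a \<in> A"
  shows "passage_time_from_set G t A a \<le> 0"
  using passage_time_from_set_le[OF assms, of t a] passage_time_refl_le[of a t] assms by force

lemma passage_time_from_set_step:
  assumes nonneg: "\<And>e. e \<in> edges G \<Longrightarrow> 0 \<le> t e"
    and A: "A \<subseteq> verts G" "A \<noteq> {}" and e: "e \<in> arcs G"
  shows "passage_time_from_set G t A (head G e)
           \<le> passage_time_from_set G t A (tail G e) + t (arc_edge G e)"
proof -
  obtain a where a: "a \<in> A"
      "passage_time_from_set G t A (tail G e) = passage_time G t a (tail G e)"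
    using passage_time_from_set_attained[OF A] .
  have "passage_time G t a (head G e) \<le> passage_time G t a (tail G e) + t (arc_edge G e)"
    using a A e by (intro passage_time_step nonneg reach) auto
  thus ?thesis using passage_time_from_set_le[OF A(1) a(1), of t "head G e"] a(2) by simp
qed

lemma potential_le_passage_time_from_set:
  assumes "\<And>e. e \<in> arcs G \<Longrightarrow> h (head G e) \<le> h (tail G e) + t (arc_edge G e)"
    and "\<And>a. a \<in> A \<Longrightarrow> h a \<le> 0" and A: "A \<subseteq> verts G" "A \<noteq> {}" and u: "u \<in> verts G"
  shows "h u \<le> passage_time_from_set G t A u"
proof -
  obtain a where a: "a \<in> A" "passage_time_from_set G t A u = passage_time G t a u"
    using passage_time_from_set_attained[OF A] .
  obtain p where p: "apath a p u" "passage_time G t a u = path_passage_time G t p"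
    using passage_time_attained[of a u t] reach[of a u] a A u by blast
  show ?thesis
    using potential_le_path[of h t a p u, OF assms(1)] awalkI_apath[OF p(1)] p(2) a assms(2)[of a]
    by simp
qed

lemma passage_time_from_set_le_flooding:
  "u \<in> verts G \<Longrightarrow> passage_time_from_set G t A u \<le> flooding_time_from_set G t A"
  unfolding flooding_time_from_set_def by (rule Max_ge) auto

lemma flooding_time_from_set_leI:
  "(\<And>u. u \<in> verts G \<Longrightarrow> passage_time_from_set G t A u \<le> c) \<Longrightarrow> flooding_time_from_set G t A \<le> c"
  unfolding flooding_time_from_set_def using verts_nonempty by (subst Max_le_iff) auto

lemma flooding_time_from_set_mono:
  assumes A: "A \<subseteq> verts G" "A \<noteq> {}" and le: "\<And>e. e \<in> edges G \<Longrightarrow> t e \<le> t' e"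
  shows "flooding_time_from_set G t A \<le> flooding_time_from_set G t' A"
proof (rule flooding_time_from_set_leI)
  fix u assume u: "u \<in> verts G"
  obtain a where a: "a \<in> A" "passage_time_from_set G t' A u = passage_time G t' a u"
    using passage_time_from_set_attained[OF A] .
  have "passage_time_from_set G t A u \<le> passage_time G t a u"
    using A a by (intro passage_time_from_set_le) auto
  also have "\<dots> \<le> passage_time G t' a u"
    using A a u le by (intro passage_time_mono reach) auto
  also have "\<dots> \<le> flooding_time_from_set G t' A"
    using a(2) passage_time_from_set_le_flooding[OF u, of t' A] by simp
  finally show "passage_time_from_set G t A u \<le> flooding_time_from_set G t' A" .
qed

lemma flooding_time_from_all: "flooding_time_from_set G t (verts G) \<le> 0"
  by (intro flooding_time_from_set_leI passage_time_from_set_source_le) auto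

lemma flooding_time_from_singleton:
  "flooding_time_from_set G t {v} = flooding_time_from G t v"
  unfolding flooding_time_from_set_def flooding_time_from_def passage_time_from_set_def
  using verts_nonempty by (subst cSup_eq_Max) auto

lemma max_flooding_time_ge:
  assumes "u \<in> verts G" "v \<in> verts G"
  shows "passage_time G t u v \<le> max_flooding_time G t"
proof -
  have "passage_time G t u v \<le> flooding_time_from G t u"
    using passage_time_from_set_le_flooding[OF assms(2), of t "{u}"]
    by (simp add: flooding_time_from_singleton passage_time_from_set_def)
  also have "\<dots> \<le> max_flooding_time G t"
    unfolding max_flooding_time_def using assms by (intro Max_ge) auto
  finally show ?thesis .
qed

text \<open>
  One step of the exploration. Let \<open>e\<close> be the fastest edge leaving \<open>A\<close>, with passage time \<open>m\<close>. The first
  vertex outside \<open>A\<close> is reached at time \<open>m\<close>, across \<open>e\<close>. From then on the graph is flooded from \<open>A\<close>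
  together with this vertex, and the edges leaving \<open>A\<close> have only their residual passage times to go.
  The truncated passage time \<open>max (d - m) 0\<close> is a potential for the residual passage times, which
  gives the comparison by duality.
\<close>

lemma flooding_time_from_set_step:
  assumes nonneg: "\<And>f. f \<in> edges G \<Longrightarrow> 0 \<le> t f"
    and A: "A \<subseteq> verts G" and e: "e \<in> arcs G" "tail G e \<in> A"
    and min: "\<And>f. f \<in> edge_boundary G A \<Longrightarrow> t (arc_edge G e) \<le> t f"
  shows "flooding_time_from_set G t A \<le> t (arc_edge G e)
    + flooding_time_from_set G (\<lambda>f. t f - t (arc_edge G e) * indicator (edge_boundary G A) f)
        (insert (head G e) A)"
proof -
  define m where "m = t (arc_edge G e)"
  define t' where "t' f = t f - m * indicator (edge_boundary G A) f" for f
  define d where "d = passage_time_from_set G t A"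
  define h where "h u = max (d u - m) 0" for u
  let ?B = "insert (head G e) A"
  have B: "?B \<subseteq> verts G" "A \<noteq> {}"
    using A e by auto
  have m: "0 \<le> m"
    unfolding m_def using e by (auto intro!: nonneg)
  have t': "0 \<le> t' f" if "f \<in> edges G" for f
    using nonneg[OF that] min[of f] by (auto simp: t'_def m_def indicator_def)
  have d_step: "d (head G f) \<le> d (tail G f) + t (arc_edge G f)" if "f \<in> arcs G" for f
    unfolding d_def using A B that by (intro passage_time_from_set_step nonneg) auto
  have d_A: "d a \<le> 0" if "a \<in> A" for a
    unfolding d_def using that A by (rule passage_time_from_set_source_le[rotated])
  have h_A: "h a = 0" if "a \<in> A" for a
    using d_A[OF that] m by (auto simp: h_def)
  have h_b: "h (head G e) = 0"
    using d_step[OF e(1)] d_A[OF e(2)] by (auto simp: h_def m_def)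
  \<comment> \<open>Crossing the boundary of \<open>A\<close> outwards costs \<open>m\<close> less than before, but the potential is 0 on \<open>A\<close>, and
    outside it has been lowered by \<open>m\<close>. All other edges keep their passage times, and truncation does
    not increase differences.\<close>
  have h_step: "h (head G f) \<le> h (tail G f) + t' (arc_edge G f)" if f: "f \<in> arcs G" for f
  proof -
    consider "head G f \<in> A" | "tail G f \<in> A" "head G f \<notin> A" | "tail G f \<notin> A" "head G f \<notin> A"
      by blast
    thus ?thesis
    proof cases
      case 1
      thus ?thesis using h_A[of "head G f"] t'[of "arc_edge G f"] arc_edge_in_edges[OF f]
        by (simp add: h_def[of "tail G f"])
    next
      case 2
      hence "arc_edge G f \<in> edge_boundary G A"
        using f by (auto simp: edge_boundary_def)
      thus ?thesis
        using min[of "arc_edge G f"] d_step[OF f] h_A[of "tail G f"] d_A[of "tail G f"] 2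
        by (auto simp: h_def t'_def m_def)
    next
      case 3
      hence "arc_edge G f \<notin> edge_boundary G A"
        by (auto simp: edge_boundary_def arc_edge_def doubleton_eq_iff)
      thus ?thesis
        using d_step[OF f] nonneg[OF arc_edge_in_edges[OF f]] by (auto simp: h_def t'_def)
    qed
  qed
  show ?thesis
  proof (rule flooding_time_from_set_leI)
    fix u assume u: "u \<in> verts G"
    have "d u - m \<le> h u" by (simp add: h_def)
    also have "\<dots> \<le> passage_time_from_set G t' ?B u"
      using h_step h_A h_b B u by (intro potential_le_passage_time_from_set) auto
    also have "\<dots> \<le> flooding_time_from_set G t' ?B"
      by (rule passage_time_from_set_le_flooding[OF u])
    finally show "passage_time_from_set G t A u \<le> t (arc_edge G e)
      + flooding_time_from_set G (\<lambda>f. t f - t (arc_edge G e) * indicator (edge_boundary G A) f) ?B"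
      by (simp add: d_def m_def t'_def[abs_def])
  qed
qed

end

section \<open>Memorylessness of exponential families\<close>

abbreviation std_exponential :: "real measure" where
  "std_exponential \<equiv> density lborel (exponential_density 1)"

abbreviation exponential_family :: "'i set \<Rightarrow> ('i \<Rightarrow> real) measure" where
  "exponential_family E \<equiv> PiM E (\<lambda>_. std_exponential)"

interpretation std_exponential: prob_space std_exponential
  by (rule prob_space_exponential_density) simp

interpretation exponentials: product_sigma_finite "\<lambda>_::'i. std_exponential"
  by (rule product_sigma_finite.intro) unfold_locales

lemma prob_space_exponential_family: "prob_space (exponential_family E)"
  by (intro prob_space_PiM std_exponential.prob_space_axioms)

lemma sets_exponential_family: "sets (exponential_family E) = sets (PiM E (\<lambda>_. borel))"
  by (rule sets_PiM_cong) auto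

lemma measurable_exponential_family:
  "borel_measurable (exponential_family E) = borel_measurable (PiM E (\<lambda>_. borel))"
  by (rule measurable_cong_sets) (auto simp: sets_exponential_family)

lemma AE_std_exponential_nonneg: "AE x in std_exponential. 0 \<le> x"
  by (subst AE_density) (auto simp: exponential_density_def)

lemma AE_exponential_family_nonneg:
  assumes "finite E"
  shows "AE w in exponential_family E. \<forall>e\<in>E. 0 \<le> w e"
  using assms
  by (intro AE_finite_allI AE_PiM_component std_exponential.prob_space_axioms
        AE_std_exponential_nonneg)

lemma nn_integral_exp_std_exponential:
  assumes "c < 1"
  shows "(\<integral>\<^sup>+x. ennreal (exp (c * x)) \<partial>std_exponential) = ennreal (1 / (1 - c))"
proof -
  interpret D: prob_space "density lborel (exponential_density (1 - c))"
    using assms by (intro prob_space_exponential_density) simp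
  have eq: "exponential_density 1 x * exp (c * x) = 1 / (1 - c) * exponential_density (1 - c) x" for x
    using assms by (auto simp: exponential_density_def field_simps exp_diff exp_minus)
  have "(\<integral>\<^sup>+x. ennreal (exp (c * x)) \<partial>std_exponential)
      = (\<integral>\<^sup>+x. ennreal (exponential_density 1 x * exp (c * x)) \<partial>lborel)"
    by (subst nn_integral_density) (auto simp: ennreal_mult' exponential_density_nonneg)
  also have "\<dots> = (\<integral>\<^sup>+x. ennreal (1 / (1 - c)) * ennreal (exponential_density (1 - c) x) \<partial>lborel)"
    unfolding eq using assms
    by (intro nn_integral_cong ennreal_mult) (auto simp: exponential_density_nonneg)
  also have "\<dots> = ennreal (1 / (1 - c)) * (\<integral>\<^sup>+x. 1 \<partial>density lborel (exponential_density (1 - c)))"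
    by (subst nn_integral_cmult) (auto simp: emeasure_density)
  also have "\<dots> = ennreal (1 / (1 - c))"
    using D.emeasure_space_1 by simp
  finally show ?thesis .
qed

lemma nn_integral_exp_neg_sum:
  assumes "finite E" "S \<subseteq> E" "0 \<le> s"
  shows "(\<integral>\<^sup>+w. ennreal (exp (- s * (\<Sum>e\<in>S. w e))) \<partial>exponential_family E)
           = ennreal ((1 / (1 + s)) ^ card S)"
proof -
  define f where "f e x = (if e \<in> S then ennreal (exp (- s * x)) else 1)" for e x
  have "ennreal (exp (- s * (\<Sum>e\<in>S. w e))) = (\<Prod>e\<in>E. f e (w e))" for w
  proof -
    have "ennreal (exp (- s * (\<Sum>e\<in>S. w e))) = ennreal (\<Prod>e\<in>S. exp (- s * w e))"
      using finite_subset[OF assms(2,1)] by (simp only: sum_distrib_left exp_sum)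
    also have "\<dots> = (\<Prod>e\<in>S. f e (w e))"
      by (simp add: prod_ennreal f_def)
    also have "\<dots> = (\<Prod>e\<in>E. f e (w e))"
      using assms by (intro prod.mono_neutral_left) (auto simp: f_def)
    finally show ?thesis .
  qed
  hence "(\<integral>\<^sup>+w. ennreal (exp (- s * (\<Sum>e\<in>S. w e))) \<partial>exponential_family E)
      = (\<Prod>e\<in>E. \<integral>\<^sup>+x. f e x \<partial>std_exponential)"
    using assms(1) by (simp only:) (rule exponentials.product_nn_integral_prod, auto simp: f_def)
  also have "\<dots> = (\<Prod>e\<in>S. \<integral>\<^sup>+x. f e x \<partial>std_exponential)"
    using assms std_exponential.emeasure_space_1
    by (intro prod.mono_neutral_right) (auto simp: f_def)
  also have "\<dots> = (\<Prod>e\<in>S. ennreal (1 / (1 + s)))"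
    using nn_integral_exp_std_exponential[of "- s"] assms(3)
    by (intro prod.cong) (auto simp: f_def)
  finally show ?thesis
    using assms(3) by (simp add: ennreal_power)
qed

text \<open>
  Subtracting \<open>s\<close> from a variable that exceeds \<open>s\<close> translates the density by \<open>s\<close>, and the exponential
  density is multiplied by \<open>exp (- s)\<close> under this translation.
\<close>

lemma std_exponential_memoryless:
  assumes [measurable]: "f \<in> borel_measurable borel" and s: "0 \<le> s"
  shows "(\<integral>\<^sup>+x. indicator {s..} x * f (x - s) \<partial>std_exponential)
           = ennreal (exp (- s)) * (\<integral>\<^sup>+x. f x \<partial>std_exponential)"
proof -
  have "(\<integral>\<^sup>+x. indicator {s..} x * f (x - s) \<partial>std_exponential)
      = (\<integral>\<^sup>+x. ennreal (exponential_density 1 x) * (indicator {s..} x * f (x - s)) \<partial>lborel)"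
    by (subst nn_integral_density) auto
  also have "\<dots> = (\<integral>\<^sup>+x. ennreal (exponential_density 1 (s + x)) * (indicator {s..} (s + x) * f x) \<partial>lborel)"
    by (subst nn_integral_real_affine[where c = 1 and t = s]) auto
  also have "\<dots> = (\<integral>\<^sup>+x. ennreal (exp (- s)) * (ennreal (exponential_density 1 x) * f x) \<partial>lborel)"
    using s by (intro nn_integral_cong)
      (auto simp: exponential_density_def indicator_def exp_diff exp_minus field_simps
         simp flip: mult.assoc ennreal_mult')
  also have "\<dots> = ennreal (exp (- s)) * (\<integral>\<^sup>+x. f x \<partial>std_exponential)"
    by (subst nn_integral_cmult) (auto simp: nn_integral_density)
  finally show ?thesis .
qed

lemma measurable_indicator_all_ge:
  assumes "finite C" "C \<subseteq> E" and [measurable]: "h \<in> borel_measurable (exponential_family E)"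
  shows "(\<lambda>w. indicator {w. \<forall>f\<in>C. h w \<le> w f} w :: ennreal) \<in> borel_measurable (exponential_family E)"
proof (rule borel_measurable_indicator')
  have "{w \<in> space (exponential_family E). h w \<le> w f} \<in> sets (exponential_family E)" if "f \<in> C" for f
  proof -
    have [measurable]: "f \<in> E" using that assms by auto
    show ?thesis by measurable
  qed
  hence "{w \<in> space (exponential_family E). \<forall>f\<in>C. h w \<le> w f} \<in> sets (exponential_family E)"
    using assms(1) by (intro sets.sets_Collect_finite_All) auto
  thus "{w \<in> space (exponential_family E). w \<in> {w. \<forall>f\<in>C. h w \<le> w f}} \<in> sets (exponential_family E)"
    by simp
qed

lemma measurable_shift_family [measurable]:
  "(\<lambda>w. \<lambda>f. w f - s * indicator C f) \<in> exponential_family E \<rightarrow>\<^sub>M exponential_family E" if "C \<subseteq> E"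
proof (rule measurable_PiM_single')
  show "(\<lambda>w f. w f - s * indicator C f) \<in> space (exponential_family E) \<rightarrow> E \<rightarrow>\<^sub>E space std_exponential"
    using that by (auto simp: space_PiM PiE_def extensional_def indicator_def)
qed auto

text \<open>
  Memorylessness in each coordinate of \<open>C\<close>: given that these coordinates exceed \<open>s\<close>, which has
  probability \<open>exp (- s * card C)\<close>, the excesses together with the other coordinates are again
  distributed as the whole family. Both the exploration for the upper bound and the conditioning on
  isolated vertices for the lower bound rest on this.
\<close>

lemma exponential_family_memoryless:
  assumes "finite E" "C \<subseteq> E" "0 \<le> s" "g \<in> borel_measurable (exponential_family E)"
  shows "(\<integral>\<^sup>+w. indicator {w. \<forall>f\<in>C. s \<le> w f} w * g (\<lambda>f. w f - s * indicator C f) \<partial>exponential_family E)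
           = ennreal (exp (- s * real (card C))) * (\<integral>\<^sup>+w. g w \<partial>exponential_family E)"
proof -
  have "finite C" using assms finite_subset by blast
  thus ?thesis using assms(2,4)
  proof (induction C arbitrary: g rule: finite_induct)
    case empty
    thus ?case by simp
  next
    case (insert c C)
    note [measurable] = insert.prems(2)
    define E' where "E' = E - {c}"
    have E: "E = insert c E'" "c \<notin> E'" "finite E'"
      using insert.prems assms(1) by (auto simp: E'_def)
    define g1 where "g1 w = indicator {s..} (w c) * g (w(c := w c - s))" for w
    have upd [measurable]: "(\<lambda>w. w(c := w c - s)) \<in> exponential_family E \<rightarrow>\<^sub>M exponential_family E"
    proof (rule measurable_PiM_single')
      show "(\<lambda>w. w(c := w c - s)) \<in> space (exponential_family E) \<rightarrow> E \<rightarrow>\<^sub>E space std_exponential"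
        using E by (auto simp: space_PiM PiE_def extensional_def)
      show "(\<lambda>w. (w(c := w c - s)) i) \<in> exponential_family E \<rightarrow>\<^sub>M std_exponential" if "i \<in> E" for i
        using that E by (cases "i = c") auto
    qed
    have [measurable]: "c \<in> E" using E by simp
    have g1 [measurable]: "g1 \<in> borel_measurable (exponential_family E)"
      unfolding g1_def by measurable
    have "(\<integral>\<^sup>+w. indicator {w. \<forall>f\<in>insert c C. s \<le> w f} w * g (\<lambda>f. w f - s * indicator (insert c C) f)
              \<partial>exponential_family E)
        = (\<integral>\<^sup>+w. indicator {w. \<forall>f\<in>C. s \<le> w f} w * g1 (\<lambda>f. w f - s * indicator C f)
              \<partial>exponential_family E)"
    proof (rule nn_integral_cong, goal_cases)
      case (1 w)
      have "(\<lambda>f. w f - s * indicator C f)(c := w c - s) = (\<lambda>f. w f - s * indicator (insert c C) f)"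
        using insert.hyps by (auto simp: fun_eq_iff indicator_def)
      thus ?case using insert.hyps by (auto simp: g1_def indicator_def)
    qed
    also have "\<dots> = ennreal (exp (- s * real (card C))) * (\<integral>\<^sup>+w. g1 w \<partial>exponential_family E)"
      using insert.prems g1 by (intro insert.IH) auto
    also have "(\<integral>\<^sup>+w. g1 w \<partial>exponential_family E)
        = (\<integral>\<^sup>+x. \<integral>\<^sup>+y. g1 (x(c := y)) \<partial>std_exponential \<partial>exponential_family E')"
      using g1 E by (simp add: exponentials.product_nn_integral_insert)
    also have "\<dots> = (\<integral>\<^sup>+x. ennreal (exp (- s)) * (\<integral>\<^sup>+y. g (x(c := y)) \<partial>std_exponential) \<partial>exponential_family E')"
    proof (rule nn_integral_cong, goal_cases)
      case (1 x)
      have "(\<lambda>y. x(c := y)) \<in> std_exponential \<rightarrow>\<^sub>M exponential_family (insert c E')"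
        using measurable_component_update[OF 1, of c] E by simp
      from measurable_compose[OF this, of g borel]
      have "(\<lambda>y. g (x(c := y))) \<in> borel_measurable borel"
        using insert.prems E by (simp cong: measurable_cong_sets)
      from std_exponential_memoryless[OF this assms(3)] show ?case
        by (simp add: g1_def)
    qed
    also have "\<dots> = ennreal (exp (- s)) * (\<integral>\<^sup>+x. (\<integral>\<^sup>+y. g (x(c := y)) \<partial>std_exponential) \<partial>exponential_family E')"
    proof (rule nn_integral_cmult)
      have "g \<in> borel_measurable (exponential_family (insert c E'))"
        using insert.prems(2) E by simp
      from measurable_compose[OF measurable_add_dim this]
      have "(\<lambda>(x, y). g (x(c := y))) \<in> borel_measurable (exponential_family E' \<Otimes>\<^sub>M std_exponential)"
        by (simp add: case_prod_beta')
      thus "(\<lambda>x. \<integral>\<^sup>+y. g (x(c := y)) \<partial>std_exponential) \<in> borel_measurable (exponential_family E')"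
        by (rule std_exponential.borel_measurable_nn_integral)
    qed
    also have "(\<integral>\<^sup>+x. (\<integral>\<^sup>+y. g (x(c := y)) \<partial>std_exponential) \<partial>exponential_family E')
        = (\<integral>\<^sup>+w. g w \<partial>exponential_family E)"
      using insert.prems(2) E by (simp add: exponentials.product_nn_integral_insert)
    finally show ?case using insert.hyps
      by (simp add: algebra_simps exp_add exp_diff exp_minus field_simps flip: mult.assoc ennreal_mult')
  qed
qed

lemma measurable_shift_by_min:
  assumes fin: "finite E" and C: "C \<subseteq> E" "e \<in> C"
    and \<phi>[measurable]: "\<phi> \<in> borel_measurable borel"
    and g[measurable]: "g \<in> borel_measurable (exponential_family E)"
  shows "(\<lambda>w. indicator {w. \<forall>f\<in>C. w e \<le> w f} w * (\<phi> (w e) * g (\<lambda>f. w f - w e * indicator C f)) :: ennreal)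
           \<in> borel_measurable (exponential_family E)"
proof -
  have [measurable]: "e \<in> E" using C by auto
  have shift: "(\<lambda>w f. w f - w e * indicator C f) \<in> exponential_family E \<rightarrow>\<^sub>M exponential_family E"
  proof (rule measurable_PiM_single')
    show "(\<lambda>w f. w f - w e * indicator C f) \<in> space (exponential_family E) \<rightarrow> E \<rightarrow>\<^sub>E space std_exponential"
      using C by (auto simp: space_PiM PiE_def extensional_def indicator_def)
  qed auto
  have "finite C" using C fin finite_subset by blast
  have "(\<lambda>w. indicator {w. \<forall>f\<in>C. w e \<le> w f} w :: ennreal) \<in> borel_measurable (exponential_family E)"
    using \<open>finite C\<close> C by (intro measurable_indicator_all_ge) auto
  thus ?thesis
    using measurable_compose[OF shift g] by simp
qed

text \<open>
  Memorylessness at the random time \<open>w e\<close> when \<open>e\<close> is the minimal coordinate in \<open>C\<close>. Fixing the value \<open>s\<close> of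
  this coordinate reduces it to a fixed time for the other coordinates of \<open>C\<close>. The residual value at \<open>e\<close>
  itself is 0 instead of a fresh exponential variable, and monotonicity of \<open>g\<close> in this coordinate allows
  it to be replaced by a fresh one, at the price of an inequality.
\<close>

lemma exponential_family_min:
  assumes fin: "finite E" and C: "C \<subseteq> E" "e \<in> C"
    and \<phi>[measurable]: "\<phi> \<in> borel_measurable borel"
    and g[measurable]: "g \<in> borel_measurable (exponential_family E)"
    and mono: "\<And>w. w \<in> space (exponential_family E) \<Longrightarrow> (\<forall>f\<in>E. 0 \<le> w f) \<Longrightarrow> g (w(e := 0)) \<le> g w"
  shows "(\<integral>\<^sup>+w. indicator {w. \<forall>f\<in>C. w e \<le> w f} w * (\<phi> (w e) * g (\<lambda>f. w f - w e * indicator C f))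
             \<partial>exponential_family E)
       \<le> (\<integral>\<^sup>+s. \<phi> s * ennreal (exp (- s * real (card C - 1))) \<partial>std_exponential)
           * (\<integral>\<^sup>+w. g w \<partial>exponential_family E)"
proof -
  define E' where "E' = E - {e}"
  define C' where "C' = C - {e}"
  have E: "E = insert e E'" "e \<notin> E'" "finite E'"
    using C fin by (auto simp: E'_def)
  have C': "C = insert e C'" "e \<notin> C'" "C' \<subseteq> E'" "card C' = card C - 1" "finite C'"
    using C fin finite_subset[OF C(1) fin] by (auto simp: C'_def E'_def)
  have [measurable]: "e \<in> E" using C by auto
  define h where "h x = g (x(e := 0))" for x
  have g': "g \<in> borel_measurable (exponential_family (insert e E'))"
    using g E by simp
  have "(\<lambda>x. x(e := 0)) \<in> exponential_family E' \<rightarrow>\<^sub>M exponential_family (insert e E')"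
    by (rule measurable_fun_upd[where J = E']) auto
  from measurable_compose[OF this g'] have h[measurable]: "h \<in> borel_measurable (exponential_family E')"
    unfolding h_def[abs_def] .
  note meas = measurable_shift_by_min[OF fin C \<phi> g]
  have "(\<integral>\<^sup>+w. indicator {w. \<forall>f\<in>C. w e \<le> w f} w * (\<phi> (w e) * g (\<lambda>f. w f - w e * indicator C f))
             \<partial>exponential_family E)
      = (\<integral>\<^sup>+s. \<integral>\<^sup>+x. indicator {w. \<forall>f\<in>C. w e \<le> w f} (x(e := s)) *
            (\<phi> s * g (\<lambda>f. (x(e := s)) f - s * indicator C f)) \<partial>exponential_family E' \<partial>std_exponential)"
    using meas E by (simp add: exponentials.product_nn_integral_insert_rev)
  also have "\<dots> = (\<integral>\<^sup>+s. \<integral>\<^sup>+x. \<phi> s * (indicator {w. \<forall>f\<in>C'. s \<le> w f} x *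
            h (\<lambda>f. x f - s * indicator C' f)) \<partial>exponential_family E' \<partial>std_exponential)"
  proof (intro nn_integral_cong, goal_cases)
    case (1 s x)
    have "(\<lambda>f. (x(e := s)) f - s * indicator C f) = (\<lambda>f. x f - s * indicator C' f)(e := 0)"
      using C' by (auto simp: fun_eq_iff indicator_def)
    thus ?case using C' by (auto simp: h_def indicator_def)
  qed
  also have "\<dots> = (\<integral>\<^sup>+s. (\<phi> s * ennreal (exp (- s * real (card C - 1))))
        * (\<integral>\<^sup>+x. h x \<partial>exponential_family E') \<partial>std_exponential)"
  proof (rule nn_integral_cong_AE, rule AE_mp[OF AE_std_exponential_nonneg], rule AE_I2, rule impI)
    fix s :: real assume s: "0 \<le> s"
    have "(\<lambda>w. indicator {w. \<forall>f\<in>C'. s \<le> w f} w :: ennreal) \<in> borel_measurable (exponential_family E')"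
      using C' by (intro measurable_indicator_all_ge) auto
    moreover have "(\<lambda>x. h (\<lambda>f. x f - s * indicator C' f)) \<in> borel_measurable (exponential_family E')"
      using measurable_compose[OF measurable_shift_family[OF C'(3)] h] .
    ultimately show "(\<integral>\<^sup>+x. \<phi> s * (indicator {w. \<forall>f\<in>C'. s \<le> w f} x *
            h (\<lambda>f. x f - s * indicator C' f)) \<partial>exponential_family E')
        = (\<phi> s * ennreal (exp (- s * real (card C - 1)))) * (\<integral>\<^sup>+x. h x \<partial>exponential_family E')"
      using exponential_family_memoryless[OF E(3) C'(3) s h] C'(4)
      by (subst nn_integral_cmult) (auto simp: mult.assoc)
  qed
  also have "\<dots> = (\<integral>\<^sup>+s. \<phi> s * ennreal (exp (- s * real (card C - 1))) \<partial>std_exponential)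
        * (\<integral>\<^sup>+x. h x \<partial>exponential_family E')"
    by (intro nn_integral_multc) simp
  also have "(\<integral>\<^sup>+x. h x \<partial>exponential_family E') \<le> (\<integral>\<^sup>+w. g w \<partial>exponential_family E)"
  proof -
    have "(\<integral>\<^sup>+x. h x \<partial>exponential_family E')
        \<le> (\<integral>\<^sup>+x. \<integral>\<^sup>+y. g (x(e := y)) \<partial>std_exponential \<partial>exponential_family E')"
    proof (rule nn_integral_mono_AE, rule AE_mp[OF AE_exponential_family_nonneg[OF E(3)]],
        rule AE_I2, rule impI)
      fix x assume x: "x \<in> space (exponential_family E')" "\<forall>f\<in>E'. 0 \<le> x f"
      have "h x = (\<integral>\<^sup>+y. h x \<partial>std_exponential)"
        using std_exponential.emeasure_space_1 by simp
      also have "\<dots> \<le> (\<integral>\<^sup>+y. g (x(e := y)) \<partial>std_exponential)"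
      proof (rule nn_integral_mono_AE, rule AE_mp[OF AE_std_exponential_nonneg],
          rule AE_I2, rule impI)
        fix y :: real assume y: "0 \<le> y"
        have "x(e := y) \<in> space (exponential_family E)"
          using x E by (auto simp: space_PiM PiE_def extensional_def)
        thus "h x \<le> g (x(e := y))"
          using mono[of "x(e := y)"] x E y by (auto simp: h_def)
      qed
      finally show "h x \<le> (\<integral>\<^sup>+y. g (x(e := y)) \<partial>std_exponential)" .
    qed
    thus ?thesis using g E by (simp add: exponentials.product_nn_integral_insert)
  qed
  finally show ?thesis by (simp add: mult_left_mono)
qed

section \<open>Exponential moments of the flooding time\<close>

context fin_digraph
begin

lemma measurable_path_passage_time:
  "set p \<subseteq> arcs G \<Longrightarrow> (\<lambda>t. path_passage_time G t p) \<in> borel_measurable (exponential_family (edges G))"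
proof (induction p)
  case (Cons e p)
  hence [measurable]: "arc_edge G e \<in> edges G"
    and [measurable]: "(\<lambda>t. path_passage_time G t p) \<in> borel_measurable (exponential_family (edges G))"
    by auto
  show ?case by simp
qed simp

lemma measurable_passage_time:
  assumes "a \<rightarrow>\<^sup>* u"
  shows "(\<lambda>t. passage_time G t a u) \<in> borel_measurable (exponential_family (edges G))"
  unfolding passage_time_def
  by (intro borel_measurable_Min measurable_path_passage_time) (auto simp: apaths_finite dest!: awalkI_apath)

end

context strongly_connected_digraph
begin

lemma measurable_passage_time_from_set:
  assumes "A \<subseteq> verts G" "u \<in> verts G"
  shows "(\<lambda>t. passage_time_from_set G t A u) \<in> borel_measurable (exponential_family (edges G))"
  unfolding passage_time_from_set_def using assms
  by (intro borel_measurable_Min measurable_passage_time) (auto dest: finite_sources intro: reach)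

lemma measurable_flooding_time_from_set:
  assumes "A \<subseteq> verts G"
  shows "(\<lambda>t. flooding_time_from_set G t A) \<in> borel_measurable (exponential_family (edges G))"
  unfolding flooding_time_from_set_def using assms
  by (intro borel_measurable_Max measurable_passage_time_from_set) auto

lemma measurable_max_flooding_time:
  "(\<lambda>t. max_flooding_time G t) \<in> borel_measurable (exponential_family (edges G))"
  unfolding max_flooding_time_def
  using measurable_flooding_time_from_set[of "{v}" for v]
  by (intro borel_measurable_Max) (auto simp: flooding_time_from_singleton)

text \<open>
  The exploration step at the level of exponential moments. With \<open>k\<close> edges leaving \<open>A\<close>, the fastest of them
  takes an exponential time of parameter \<open>k\<close>, whose exponential moment is \<open>k / (k - \<theta>)\<close>, and
  afterwards the residual passage times are independent of this time and as good as new. The integral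
  is split according to which of the \<open>k\<close> edges is the fastest; each of them contributes at most
  \<open>K / (k - \<theta>)\<close>.
\<close>

lemma exp_moment_flooding_step:
  assumes A: "A \<subseteq> verts G" "A \<noteq> {}"
    and \<theta>: "0 \<le> \<theta>" "\<theta> < real (card (edge_boundary G A))"
    and K: "\<And>b. b \<in> verts G - A \<Longrightarrow>
      (\<integral>\<^sup>+w. ennreal (exp (\<theta> * flooding_time_from_set G w (insert b A))) \<partial>exponential_family (edges G)) \<le> K"
  shows "(\<integral>\<^sup>+w. ennreal (exp (\<theta> * flooding_time_from_set G w A)) \<partial>exponential_family (edges G))
      \<le> ennreal (real (card (edge_boundary G A)) / (real (card (edge_boundary G A)) - \<theta>)) * K"
proof -
  define C where "C = edge_boundary G A"
  define k where "k = card C"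
  have C: "C \<subseteq> edges G" "finite C" "C \<noteq> {}"
    using edge_boundary_subset finite_subset[OF edge_boundary_subset] \<theta> by (auto simp: C_def)
  have "\<forall>f\<in>C. \<exists>e. e \<in> arcs G \<and> tail G e \<in> A \<and> head G e \<notin> A \<and> arc_edge G e = f"
    by (auto simp: C_def edge_boundary_def)
  then obtain r where r: "\<And>f. f \<in> C \<Longrightarrow> r f \<in> arcs G" "\<And>f. f \<in> C \<Longrightarrow> tail G (r f) \<in> A"
      "\<And>f. f \<in> C \<Longrightarrow> head G (r f) \<notin> A" "\<And>f. f \<in> C \<Longrightarrow> arc_edge G (r f) = f"
    by metis
  define B where "B f = insert (head G (r f)) A" for f
  have B: "B f \<subseteq> verts G" "B f \<noteq> {}" if "f \<in> C" for f
    using A r[OF that] by (auto simp: B_def)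
  define \<phi> where "\<phi> s = ennreal (exp (\<theta> * s))" for s
  define g where "g f w = \<phi> (flooding_time_from_set G w (B f))" for f w
  define H where "H f w = indicator {w. \<forall>f'\<in>C. w f \<le> w f'} w
      * (\<phi> (w f) * g f (\<lambda>f'. w f' - w f * indicator C f'))" for f w
  have \<phi>_meas [measurable]: "\<phi> \<in> borel_measurable borel"
    unfolding \<phi>_def by measurable
  have g_meas: "g f \<in> borel_measurable (exponential_family (edges G))" if "f \<in> C" for f
    using measurable_flooding_time_from_set[OF B(1)[OF that]] unfolding g_def[abs_def] by measurable
  have H_meas: "H f \<in> borel_measurable (exponential_family (edges G))" if "f \<in> C" for f
    unfolding H_def[abs_def] using C that g_meas
    by (intro measurable_shift_by_min) auto
  have \<phi>_mono: "\<phi> x \<le> \<phi> y" if "x \<le> y" for x y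
    using that \<theta> by (auto simp: \<phi>_def intro!: ennreal_leI mult_left_mono)
  have "(\<integral>\<^sup>+w. \<phi> (flooding_time_from_set G w A) \<partial>exponential_family (edges G))
      \<le> (\<integral>\<^sup>+w. (\<Sum>f\<in>C. H f w) \<partial>exponential_family (edges G))"
  proof (rule nn_integral_mono_AE, rule AE_mp[OF AE_exponential_family_nonneg[OF finite_edges]],
      rule AE_I2, rule impI)
    fix w :: "'a set \<Rightarrow> real" assume w: "\<forall>e\<in>edges G. 0 \<le> w e"
    obtain f where f: "f \<in> C" "\<And>f'. f' \<in> C \<Longrightarrow> w f \<le> w f'"
      using arg_min_if_finite[OF C(2,3), of w] by (meson not_le)
    have "flooding_time_from_set G w A
        \<le> w f + flooding_time_from_set G (\<lambda>f'. w f' - w f * indicator C f') (B f)"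
      using flooding_time_from_set_step[of w A "r f"] w A(1) f r[OF f(1)] by (simp add: C_def B_def)
    hence "\<phi> (flooding_time_from_set G w A)
        \<le> \<phi> (w f + flooding_time_from_set G (\<lambda>f'. w f' - w f * indicator C f') (B f))"
      by (rule \<phi>_mono)
    also have "\<dots> = H f w"
      using f by (simp add: H_def g_def \<phi>_def distrib_left exp_add ennreal_mult)
    also have "\<dots> \<le> (\<Sum>f\<in>C. H f w)"
      using f C by (intro member_le_sum) auto
    finally show "\<phi> (flooding_time_from_set G w A) \<le> (\<Sum>f\<in>C. H f w)" .
  qed
  also have "\<dots> = (\<Sum>f\<in>C. \<integral>\<^sup>+w. H f w \<partial>exponential_family (edges G))"
    by (intro nn_integral_sum H_meas)
  also have "\<dots> \<le> (\<Sum>f\<in>C. ennreal (1 / (real k - \<theta>)) * K)"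
  proof (rule sum_mono)
    fix f assume f: "f \<in> C"
    have "k \<ge> 1"
      using C by (simp add: k_def Suc_le_eq card_gt_0_iff)
    have "(\<integral>\<^sup>+w. H f w \<partial>exponential_family (edges G))
        \<le> (\<integral>\<^sup>+s. \<phi> s * ennreal (exp (- s * real (k - 1))) \<partial>std_exponential)
            * (\<integral>\<^sup>+w. g f w \<partial>exponential_family (edges G))"
      unfolding H_def k_def
    proof (rule exponential_family_min)
      fix w :: "'a set \<Rightarrow> real" assume "\<forall>e\<in>edges G. 0 \<le> w e"
      thus "g f (w(f := 0)) \<le> g f w"
        unfolding g_def using B[OF f] by (intro \<phi>_mono flooding_time_from_set_mono) auto
    qed (use C f g_meas in auto)
    also have "(\<lambda>s. \<phi> s * ennreal (exp (- s * real (k - 1)))) = (\<lambda>s. ennreal (exp ((\<theta> - real (k - 1)) * s)))"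
      by (simp add: \<phi>_def algebra_simps exp_diff fun_eq_iff exp_minus divide_inverse flip: ennreal_mult exp_add)
    also have "(\<integral>\<^sup>+s. ennreal (exp ((\<theta> - real (k - 1)) * s)) \<partial>std_exponential) = ennreal (1 / (real k - \<theta>))"
      using \<theta> \<open>k \<ge> 1\<close> by (subst nn_integral_exp_std_exponential) (auto simp: k_def C_def of_nat_diff)
    also have "(\<integral>\<^sup>+w. g f w \<partial>exponential_family (edges G)) \<le> K"
      using K[of "head G (r f)"] r[OF f] by (simp add: g_def \<phi>_def B_def)
    finally show "(\<integral>\<^sup>+w. H f w \<partial>exponential_family (edges G)) \<le> ennreal (1 / (real k - \<theta>)) * K"
      by (simp add: mult_left_mono)
  qed
  also have "\<dots> = ennreal (real k / (real k - \<theta>)) * K"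
  proof -
    have "ennreal (real k) * ennreal (1 / (real k - \<theta>)) = ennreal (real k / (real k - \<theta>))"
      by (subst ennreal_mult' [symmetric]) auto
    thus ?thesis
      by (simp add: k_def ennreal_of_nat_eq_real_of_nat flip: mult.assoc)
  qed
  finally show ?thesis by (simp add: \<phi>_def k_def C_def)
qed

end

lemma complete_graph_simps [simp]:
  "verts (complete_graph n) = {..<n}"
  "arcs (complete_graph n) = {(u, v). u < n \<and> v < n \<and> u \<noteq> v}"
  "tail (complete_graph n) = fst" "head (complete_graph n) = snd"
  "arc_edge (complete_graph n) e = {fst e, snd e}"
  by (auto simp: complete_graph_def arc_edge_def)

lemma strongly_connected_complete_graph:
  assumes "n > 0"
  shows "strongly_connected_digraph (complete_graph n)"
proof -
  interpret graph "complete_graph n"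
    using complete_digraph_complete_graph[of n] by (simp add: complete_digraph_def)
  have "u \<rightarrow>\<^sup>*\<^bsub>complete_graph n\<^esub> v" if "u < n" "v < n" for u v
  proof (cases "u = v")
    case False
    hence "awalk u [(u, v)] v"
      using that by (auto simp: awalk_def)
    thus ?thesis by (rule reachable_awalkI)
  qed (use that in auto)
  thus ?thesis
    using assms by unfold_locales (auto simp: strongly_connected_def)
qed

lemma card_edge_boundary_complete_graph:
  assumes "A \<subseteq> {..<n}"
  shows "card (edge_boundary (complete_graph n) A) = card A * (n - card A)"
proof -
  have "edge_boundary (complete_graph n) A = (\<lambda>(u, v). {u, v}) ` (A \<times> ({..<n} - A))"
    using assms by (force simp: edge_boundary_def image_iff)
  also have "card \<dots> = card (A \<times> ({..<n} - A))"
    by (rule card_image) (auto simp: inj_on_def doubleton_eq_iff)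
  also have "\<dots> = card A * (n - card A)"
    using assms by (simp add: card_cartesian_product card_Diff_subset finite_subset)
  finally show ?thesis .
qed

lemma pred_le_mult_diff:
  fixes k n :: nat
  assumes "1 \<le> k" "k < n"
  shows "real n - 1 \<le> real (k * (n - k))"
proof -
  have "0 \<le> (real k - 1) * (real n - real k - 1)"
    using assms by (intro mult_nonneg_nonneg) auto
  thus ?thesis using assms by (simp add: of_nat_diff algebra_simps)
qed

text \<open>
  In the complete graph a set of \<open>k\<close> vertices is left by \<open>k * (n - k)\<close> edges, whichever set it is. The
  exploration step can therefore be iterated until all vertices are wet. The condition on \<open>\<theta>\<close> comes
  from the two slowest steps, \<open>k = 1\<close> and \<open>k = n - 1\<close>.
\<close>

lemma exp_moment_flooding_complete_graph:
  assumes \<theta>: "0 \<le> \<theta>" "\<theta> < real n - 1" and A: "A \<subseteq> {..<n}" "A \<noteq> {}"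
  shows "(\<integral>\<^sup>+w. ennreal (exp (\<theta> * flooding_time_from_set (complete_graph n) w A))
             \<partial>exponential_family (edges (complete_graph n)))
         \<le> (\<Prod>k\<in>{card A..<n}. ennreal (real (k * (n - k)) / (real (k * (n - k)) - \<theta>)))"
  using A
proof (induction "n - card A" arbitrary: A)
  case 0
  interpret strongly_connected_digraph "complete_graph n"
    using \<theta> by (intro strongly_connected_complete_graph) auto
  interpret P: prob_space "exponential_family (edges (complete_graph n))"
    by (rule prob_space_exponential_family)
  have "card A = n"
    using 0 card_mono[of "{..<n}" A] by simp
  hence "A = {..<n}"
    using 0 by (intro card_subset_eq) auto
  hence "(\<integral>\<^sup>+w. ennreal (exp (\<theta> * flooding_time_from_set (complete_graph n) w A))
             \<partial>exponential_family (edges (complete_graph n)))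
       \<le> (\<integral>\<^sup>+w. 1 \<partial>exponential_family (edges (complete_graph n)))"
    using flooding_time_from_all \<theta> by (intro nn_integral_mono) (auto simp: mult_nonneg_nonpos)
  thus ?case using \<open>card A = n\<close> P.emeasure_space_1 by simp
next
  case (Suc m)
  interpret strongly_connected_digraph "complete_graph n"
    using \<theta> by (intro strongly_connected_complete_graph) auto
  have fin: "finite A" using Suc.prems finite_subset by blast
  define k where "k = card A"
  have k: "1 \<le> k" "k < n"
    using Suc fin by (auto simp: k_def Suc_le_eq card_gt_0_iff)
  have ge: "real n - 1 \<le> real (k * (n - k))"
    using k by (rule pred_le_mult_diff)
  have boundary: "card (edge_boundary (complete_graph n) A) = k * (n - k)"
    using card_edge_boundary_complete_graph Suc.prems by (simp add: k_def)
  have less: "\<theta> < real (card (edge_boundary (complete_graph n) A))"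
    unfolding boundary using \<theta> ge by linarith
  have IH: "(\<integral>\<^sup>+w. ennreal (exp (\<theta> * flooding_time_from_set (complete_graph n) w (insert b A)))
             \<partial>exponential_family (edges (complete_graph n)))
         \<le> (\<Prod>k\<in>{Suc k..<n}. ennreal (real (k * (n - k)) / (real (k * (n - k)) - \<theta>)))"
    if "b \<in> verts (complete_graph n) - A" for b
    using Suc.hyps(1)[of "insert b A"] Suc.hyps(2) Suc.prems that fin by (simp add: k_def)
  have "(\<integral>\<^sup>+w. ennreal (exp (\<theta> * flooding_time_from_set (complete_graph n) w A))
             \<partial>exponential_family (edges (complete_graph n)))
       \<le> ennreal (real (k * (n - k)) / (real (k * (n - k)) - \<theta>)) *
          (\<Prod>k\<in>{Suc k..<n}. ennreal (real (k * (n - k)) / (real (k * (n - k)) - \<theta>)))"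
    using exp_moment_flooding_step[OF _ Suc.prems(2) \<theta>(1) less IH] Suc.prems(1)
    unfolding boundary by simp
  also have "\<dots> = (\<Prod>k\<in>{k..<n}. ennreal (real (k * (n - k)) / (real (k * (n - k)) - \<theta>)))"
    using k by (simp add: prod.atLeast_Suc_lessThan)
  finally show ?case by (simp add: k_def)
qed

lemma exp_moment_max_flooding_complete_graph:
  assumes \<theta>: "0 \<le> \<theta>" "\<theta> < real n - 1"
  shows "(\<integral>\<^sup>+w. ennreal (exp (\<theta> * max_flooding_time (complete_graph n) w))
             \<partial>exponential_family (edges (complete_graph n)))
         \<le> of_nat n * (\<Prod>k\<in>{1..<n}. ennreal (real (k * (n - k)) / (real (k * (n - k)) - \<theta>)))"
proof -
  interpret strongly_connected_digraph "complete_graph n"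
    using \<theta> by (intro strongly_connected_complete_graph) auto
  define P where "P = exponential_family (edges (complete_graph n))"
  have "(\<integral>\<^sup>+w. ennreal (exp (\<theta> * max_flooding_time (complete_graph n) w)) \<partial>P)
      \<le> (\<integral>\<^sup>+w. (\<Sum>v<n. ennreal (exp (\<theta> * flooding_time_from_set (complete_graph n) w {v}))) \<partial>P)"
  proof (rule nn_integral_mono)
    fix w
    have "max_flooding_time (complete_graph n) w
        \<in> flooding_time_from (complete_graph n) w ` verts (complete_graph n)"
      unfolding max_flooding_time_def using verts_nonempty by (intro Max_in) auto
    then obtain v where v: "v < n" "max_flooding_time (complete_graph n) w
        = flooding_time_from_set (complete_graph n) w {v}"
      by (auto simp: flooding_time_from_singleton)
    show "ennreal (exp (\<theta> * max_flooding_time (complete_graph n) w))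
        \<le> (\<Sum>v<n. ennreal (exp (\<theta> * flooding_time_from_set (complete_graph n) w {v})))"
      unfolding v(2) using v(1)
      by (intro member_le_sum[where f = "\<lambda>v. ennreal (exp (\<theta> * flooding_time_from_set (complete_graph n) w {v}))"]) auto
  qed
  also have "\<dots> = (\<Sum>v<n. \<integral>\<^sup>+w. ennreal (exp (\<theta> * flooding_time_from_set (complete_graph n) w {v})) \<partial>P)"
    unfolding P_def
    by (intro nn_integral_sum measurable_compose[OF measurable_flooding_time_from_set]) auto
  also have "\<dots> \<le> (\<Sum>v<n. \<Prod>k\<in>{1..<n}. ennreal (real (k * (n - k)) / (real (k * (n - k)) - \<theta>)))"
    unfolding P_def
  proof (rule sum_mono)
    fix v assume "v \<in> {..<n}"
    thus "(\<integral>\<^sup>+w. ennreal (exp (\<theta> * flooding_time_from_set (complete_graph n) w {v}))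
             \<partial>exponential_family (edges (complete_graph n)))
         \<le> (\<Prod>k\<in>{1..<n}. ennreal (real (k * (n - k)) / (real (k * (n - k)) - \<theta>)))"
      using exp_moment_flooding_complete_graph[OF \<theta>, of "{v}"] by simp
  qed
  finally show ?thesis by (simp add: P_def)
qed

section \<open>Upper bound on the expectation\<close>

lemma sum_inverse_le_ln:
  assumes "n > 0"
  shows "(\<Sum>k\<in>{1..<n}. 1 / real k) \<le> 1 + ln (real n)"
proof -
  have "harm n - ln (real n) \<le> (harm 1 - ln (real 1) :: real)"
    using decseqD[OF decseq_harm_diff_ln, of 0 "n - 1"] assms by simp
  hence "harm n \<le> 1 + ln (real n)"
    by (simp add: harm_def)
  moreover have "(\<Sum>k\<in>{1..<n}. 1 / real k) \<le> harm n"
    unfolding harm_def by (auto simp: inverse_eq_divide intro!: sum_mono2)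
  ultimately show ?thesis by simp
qed

lemma sum_inverse_squares_le: "(\<Sum>k\<in>{1..<n}. 1 / (real k)\<^sup>2) \<le> 2"
proof -
  have "(\<Sum>k\<in>{1..<Suc m}. 1 / (real k)\<^sup>2) \<le> 2 - 1 / real m" for m
  proof (induction m)
    case (Suc m)
    show ?case
    proof (cases "m = 0")
      case False
      hence "1 / (real m + 1)\<^sup>2 \<le> 1 / (real m * (real m + 1))"
        by (intro divide_left_mono) (auto simp: power2_eq_square)
      also have "\<dots> = 1 / real m - 1 / (real m + 1)"
        using False by (simp add: field_simps)
      finally show ?thesis using Suc by (simp add: add.commute)
    qed simp
  qed simp
  from this[of "n - 1"] show ?thesis
    by (cases n) (auto intro: order.trans)
qed

text \<open>
  Since \<open>1 / (k * (n - k)) = (1 / k + 1 / (n - k)) / n\<close>, the logarithm of the product is, to first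
  order, twice a harmonic sum. The condition that \<open>\<theta>\<close> stays below \<open>n - 1\<close> by the factor \<open>1 - \<delta>\<close> keeps all
  factors away from the pole, so that the second-order terms contribute a constant of order \<open>1 / \<delta>\<close>.
\<close>

lemma exp_moment_product_bound:
  assumes n: "n \<ge> 2" and \<delta>: "0 < \<delta>" "\<delta> < 1"
  shows "(\<Prod>k\<in>{1..<n}. real (k * (n - k)) / (real (k * (n - k)) - (1 - \<delta>) * (real n - 1)))
           \<le> exp (2 * ln (real n) + 2 + 8 / \<delta>)"
proof -
  define \<theta> where "\<theta> = (1 - \<delta>) * (real n - 1)"
  define r where "r k = 1 / real k + 1 / real (n - k)" for k
  have factor: "0 \<le> real (k * (n - k)) / (real (k * (n - k)) - \<theta>)
      \<and> real (k * (n - k)) / (real (k * (n - k)) - \<theta>) \<le> exp (r k + (r k)\<^sup>2 / \<delta>)"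
    if k: "k \<in> {1..<n}" for k
  proof -
    define K where "K = real (k * (n - k))"
    define x where "x = \<theta> / K"
    have K: "real n - 1 \<le> K" "0 < K"
      using k pred_le_mult_diff[of k n] by (auto simp: K_def)
    have \<theta>: "0 \<le> \<theta>" "\<theta> \<le> real n"
      using \<delta> n mult_mono[of "1 - \<delta>" 1 "real n - 1" "real n"] by (auto simp: \<theta>_def)
    have "\<theta> \<le> (1 - \<delta>) * K"
      using \<delta> K(1) by (auto simp: \<theta>_def intro!: mult_left_mono)
    hence x: "0 \<le> x" "x \<le> 1 - \<delta>"
      using K \<theta> by (auto simp: x_def field_simps)
    have "r k = real n / K"
      using k by (simp add: r_def K_def of_nat_diff field_simps)
    hence xr: "x \<le> r k"
      using \<theta> K by (simp add: x_def divide_right_mono)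
    have "K / (K - \<theta>) = 1 / (1 - x)"
      using K by (simp add: x_def field_simps)
    also have "\<dots> \<le> exp (x / (1 - x))"
      using exp_ge_add_one_self[of "x / (1 - x)"] x \<delta> by (simp add: field_simps)
    also have "x / (1 - x) = x + x\<^sup>2 / (1 - x)"
      using x \<delta> by (simp add: field_simps power2_eq_square)
    also have "\<dots> \<le> r k + (r k)\<^sup>2 / \<delta>"
      using x xr \<delta> by (intro add_mono frac_le power_mono) auto
    finally show ?thesis using x \<delta> \<open>K / (K - \<theta>) = 1 / (1 - x)\<close> by (simp add: K_def)
  qed
  have flip: "(\<Sum>k\<in>{1..<n}. f (n - k)) = (\<Sum>k\<in>{1..<n}. f k)" for f :: "nat \<Rightarrow> real"
    by (rule sum.reindex_bij_witness[of _ "\<lambda>k. n - k" "\<lambda>k. n - k"]) auto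
  have "(\<Prod>k\<in>{1..<n}. real (k * (n - k)) / (real (k * (n - k)) - \<theta>))
      \<le> (\<Prod>k\<in>{1..<n}. exp (r k + (r k)\<^sup>2 / \<delta>))"
    by (rule prod_mono) (rule factor)
  also have "\<dots> = exp ((\<Sum>k\<in>{1..<n}. r k) + (\<Sum>k\<in>{1..<n}. (r k)\<^sup>2) / \<delta>)"
    by (simp add: sum.distrib sum_divide_distrib flip: exp_sum)
  also have "\<dots> \<le> exp (2 * ln (real n) + 2 + 8 / \<delta>)"
  proof -
    have "(\<Sum>k\<in>{1..<n}. r k) \<le> 2 * ln (real n) + 2"
      using sum_inverse_le_ln[of n] n flip[of "\<lambda>k. 1 / real k"] by (simp add: r_def sum.distrib)
    moreover have "(\<Sum>k\<in>{1..<n}. (r k)\<^sup>2) \<le> 8"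
    proof -
      have "(r k)\<^sup>2 \<le> 2 * (1 / (real k)\<^sup>2) + 2 * (1 / (real (n - k))\<^sup>2)" for k
        using sum_squares_bound[of "1 / real k" "1 / real (n - k)"]
        by (simp add: r_def power2_sum power_divide)
      hence "(\<Sum>k\<in>{1..<n}. (r k)\<^sup>2)
          \<le> (\<Sum>k\<in>{1..<n}. 2 * (1 / (real k)\<^sup>2) + 2 * (1 / (real (n - k))\<^sup>2))"
        by (intro sum_mono)
      also have "\<dots> = 2 * (\<Sum>k\<in>{1..<n}. 1 / (real k)\<^sup>2) + 2 * (\<Sum>k\<in>{1..<n}. 1 / (real (n - k))\<^sup>2)"
        by (simp only: sum.distrib sum_distrib_left)
      also have "\<dots> \<le> 8"
        using sum_inverse_squares_le[of n] flip[of "\<lambda>k. 1 / (real k)\<^sup>2"] by simp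
      finally show ?thesis .
    qed
    ultimately show ?thesis using \<delta> by (simp add: add_mono divide_right_mono)
  qed
  finally show ?thesis by (simp add: \<theta>_def)
qed

text \<open>
  This is Jensen's inequality for the exponential function, proved from the tangent to \<open>exp\<close> at \<open>ln K\<close>.
\<close>

lemma (in prob_space) expectation_le_ln_exp_moment:
  assumes [measurable]: "X \<in> borel_measurable M" and nonneg: "AE x in M. 0 \<le> X x"
    and \<theta>: "0 < \<theta>" and K: "0 < K" "(\<integral>\<^sup>+x. ennreal (exp (\<theta> * X x)) \<partial>M) \<le> ennreal K"
  shows "integrable M X" "expectation X \<le> ln K / \<theta>"
proof -
  have int: "integrable M (\<lambda>x. exp (\<theta> * X x))"
    using K(2) by (intro integrableI_bounded) (auto intro: order.strict_trans1)
  have "\<theta> * X x \<le> exp (\<theta> * X x)" for x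
    using exp_ge_add_one_self[of "\<theta> * X x"] by linarith
  hence "X x \<le> exp (\<theta> * X x) / \<theta>" for x
    using \<theta> by (simp add: field_simps)
  thus X: "integrable M X"
    using nonneg \<theta> by (intro Bochner_Integration.integrable_bound[OF integrable_divide[OF int, of \<theta>]])
      (auto elim!: eventually_mono)
  have exp_le: "expectation (\<lambda>x. exp (\<theta> * X x)) \<le> K"
    using K by (subst integral_eq_nn_integral) (auto intro: enn2real_leI)
  \<comment> \<open>The exponential function lies above its tangent at \<open>ln K\<close>.\<close>
  have "\<theta> * X x \<le> ln K - 1 + exp (\<theta> * X x) / K" for x
    using exp_ge_add_one_self[of "\<theta> * X x - ln K"] K(1) by (simp add: exp_diff)
  hence "expectation (\<lambda>x. \<theta> * X x) \<le> expectation (\<lambda>x. ln K - 1 + exp (\<theta> * X x) / K)"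
    using X int by (intro integral_mono) auto
  also have "\<dots> = ln K - 1 + expectation (\<lambda>x. exp (\<theta> * X x)) / K"
    using int by (simp add: prob_space)
  also have "\<dots> \<le> ln K"
    using exp_le K(1) by simp
  finally show "expectation X \<le> ln K / \<theta>"
    using \<theta> by (simp add: field_simps)
qed

context strongly_connected_digraph
begin

lemma max_flooding_time_nonneg:
  assumes "\<And>e. e \<in> edges G \<Longrightarrow> 0 \<le> t e"
  shows "0 \<le> max_flooding_time G t"
proof -
  obtain v where v: "v \<in> verts G" using verts_nonempty by auto
  obtain p where p: "apath v p v" "passage_time G t v v = path_passage_time G t p"
    using passage_time_attained[OF reach[OF v v], of t] by blast
  have "path_passage_time G (\<lambda>_. 0) p \<le> path_passage_time G t p"
    using p(1) assms by (intro path_passage_time_mono) (auto simp: apath_def)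
  hence "0 \<le> passage_time G t v v"
    unfolding p(2) by (simp add: path_passage_time_def)
  thus ?thesis using max_flooding_time_ge[OF v v, of t] by simp
qed

end

text \<open>
  The maximum over the \<open>n\<close> sources costs a factor \<open>n\<close> in the exponential moment, so it adds one \<open>ln n\<close> to
  the two that a single source contributes.
\<close>

lemma max_flooding_time_complete_graph_expectation_le:
  fixes n :: nat and \<delta> :: real
  defines "P \<equiv> exponential_family (edges (complete_graph n))"
  assumes n: "n \<ge> 2" and \<delta>: "0 < \<delta>" "\<delta> < 1"
  shows "integrable P (max_flooding_time (complete_graph n))"
    and "(\<integral>w. max_flooding_time (complete_graph n) w \<partial>P)
           \<le> (3 * ln (real n) + 2 + 8 / \<delta>) / ((1 - \<delta>) * (real n - 1))"
proof -
  interpret strongly_connected_digraph "complete_graph n"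
    using n by (intro strongly_connected_complete_graph) auto
  interpret prob_space P
    unfolding P_def by (rule prob_space_exponential_family)
  define \<theta> where "\<theta> = (1 - \<delta>) * (real n - 1)"
  define K where "K = exp (3 * ln (real n) + 2 + 8 / \<delta>)"
  have \<theta>: "0 < \<theta>" "\<theta> < real n - 1"
    using n \<delta> mult_strict_right_mono[of "1 - \<delta>" 1 "real n - 1"] by (auto simp: \<theta>_def)
  have "(\<integral>\<^sup>+w. ennreal (exp (\<theta> * max_flooding_time (complete_graph n) w)) \<partial>P)
      \<le> of_nat n * (\<Prod>k\<in>{1..<n}. ennreal (real (k * (n - k)) / (real (k * (n - k)) - \<theta>)))"
    unfolding P_def using \<theta> by (intro exp_moment_max_flooding_complete_graph) auto
  also have "\<dots> = ennreal (real n * (\<Prod>k\<in>{1..<n}. real (k * (n - k)) / (real (k * (n - k)) - \<theta>)))"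
  proof -
    have "0 \<le> real (k * (n - k)) / (real (k * (n - k)) - \<theta>)" if k: "k \<in> {1..<n}" for k
    proof -
      have "real n - 1 \<le> real (k * (n - k))" using k by (intro pred_le_mult_diff) auto
      hence "0 \<le> real (k * (n - k)) - \<theta>" using \<theta> by linarith
      thus ?thesis by (intro divide_nonneg_nonneg) auto
    qed
    thus ?thesis
      by (subst prod_ennreal) (auto simp: ennreal_mult' ennreal_of_nat_eq_real_of_nat)
  qed
  also have "\<dots> \<le> ennreal (real n * exp (2 * ln (real n) + 2 + 8 / \<delta>))"
    unfolding \<theta>_def using exp_moment_product_bound[OF n \<delta>] by (intro ennreal_leI mult_left_mono) auto
  also have "real n * exp (2 * ln (real n) + 2 + 8 / \<delta>) = K"
  proof -
    have "K = exp (ln (real n)) * exp (2 * ln (real n) + 2 + 8 / \<delta>)"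
      unfolding K_def exp_add [symmetric] by (simp add: algebra_simps)
    thus ?thesis using n by simp
  qed
  finally have le_K: "(\<integral>\<^sup>+w. ennreal (exp (\<theta> * max_flooding_time (complete_graph n) w)) \<partial>P) \<le> ennreal K" .
  have meas: "max_flooding_time (complete_graph n) \<in> borel_measurable P"
    unfolding P_def using measurable_max_flooding_time by simp
  have "AE w in P. 0 \<le> max_flooding_time (complete_graph n) w"
    unfolding P_def
    by (rule AE_mp[OF AE_exponential_family_nonneg[OF finite_edges]])
       (auto intro!: AE_I2 max_flooding_time_nonneg)
  note * = expectation_le_ln_exp_moment[OF meas this \<theta>(1) _ le_K]
  show "integrable P (max_flooding_time (complete_graph n))"
    using *(1) by (simp add: K_def)
  show "(\<integral>w. max_flooding_time (complete_graph n) w \<partial>P)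
           \<le> (3 * ln (real n) + 2 + 8 / \<delta>) / ((1 - \<delta>) * (real n - 1))"
    using *(2) by (simp add: K_def \<theta>_def)
qed

section \<open>Lower bound in probability\<close>

context wf_digraph
begin

text \<open>
  A path does not traverse an undirected edge in both directions either, because it does not return
  to the starting point of any of its arcs. Hence the passage times along a path are independent.
\<close>

lemma distinct_arc_edges_apath: "apath u p v \<Longrightarrow> distinct (map (arc_edge G) p)"
proof (induction p arbitrary: u)
  case (Cons e p)
  have p: "apath (head G e) p v" and e: "tail G e \<notin> set (awalk_verts (head G e) p)"
    using Cons.prems by (auto simp: apath_Cons_iff)
  have "arc_edge G e \<noteq> arc_edge G f" if "f \<in> set p" for f
  proof -
    have "tail G f \<in> set (awalk_verts (head G e) p)" "head G f \<in> set (awalk_verts (head G e) p)"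
      using awalk_verts_arc1[OF that] awalk_verts_arc2[OF _ that] awalkI_apath[OF p] by auto
    thus ?thesis using e by (auto simp: arc_edge_def doubleton_eq_iff)
  qed
  thus ?case using Cons.IH[OF p] by auto
qed simp

lemma path_passage_time_conv_sum:
  "apath u p v \<Longrightarrow> path_passage_time G t p = (\<Sum>e\<in>arc_edge G ` set p. t e)"
  using sum_list_distinct_conv_sum_set[OF distinct_arc_edges_apath, of u p v t]
  by (simp add: path_passage_time_def comp_def)

end

text \<open>
  Chernoff's bound for the sum of \<open>length p\<close> independent exponential variables.
\<close>

lemma (in fin_digraph) prob_path_passage_time_less:
  assumes p: "apath u p v" and s: "0 \<le> s"
  shows "measure (exponential_family (edges G))
           {w \<in> space (exponential_family (edges G)). path_passage_time G w p < b}
         \<le> exp (s * b) * (1 / (1 + s)) ^ length p"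
proof -
  define P where "P = exponential_family (edges G)"
  interpret P: prob_space P
    unfolding P_def by (rule prob_space_exponential_family)
  have arcs: "set p \<subseteq> arcs G" using p by (auto dest!: awalkI_apath)
  have [measurable]: "(\<lambda>w. path_passage_time G w p) \<in> borel_measurable P"
    unfolding P_def by (rule measurable_path_passage_time[OF arcs])
  have "emeasure P {w \<in> space P. path_passage_time G w p < b}
      = (\<integral>\<^sup>+w. indicator {w \<in> space P. path_passage_time G w p < b} w \<partial>P)"
    by simp
  also have "\<dots> \<le> (\<integral>\<^sup>+w. ennreal (exp (s * b)) * ennreal (exp (- s * (\<Sum>e\<in>arc_edge G ` set p. w e))) \<partial>P)"
  proof (rule nn_integral_mono)
    fix w
    \<comment> \<open>For nonnegative \<open>s\<close>, the exponential of \<open>s * (b - x)\<close> dominates the indicator of \<open>x < b\<close>.\<close>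
    have "1 \<le> exp (s * b) * exp (- s * (\<Sum>e\<in>arc_edge G ` set p. w e))"
      if "path_passage_time G w p < b"
      using that s unfolding exp_add [symmetric] path_passage_time_conv_sum[OF p]
      by (simp add: mult_left_mono)
    thus "indicator {w \<in> space P. path_passage_time G w p < b} w
        \<le> ennreal (exp (s * b)) * ennreal (exp (- s * (\<Sum>e\<in>arc_edge G ` set p. w e)))"
      by (simp add: indicator_def flip: ennreal_mult')
  qed
  also have "\<dots> = ennreal (exp (s * b)) * ennreal ((1 / (1 + s)) ^ card (arc_edge G ` set p))"
  proof -
    have sub: "arc_edge G ` set p \<subseteq> edges G" using arcs by auto
    have "(\<lambda>w. ennreal (exp (- s * (\<Sum>e\<in>arc_edge G ` set p. w e)))) \<in> borel_measurable P"
      using \<open>(\<lambda>w. path_passage_time G w p) \<in> borel_measurable P\<close>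
      unfolding path_passage_time_conv_sum[OF p] by simp
    thus ?thesis
      using nn_integral_exp_neg_sum[OF finite_edges sub s] by (subst nn_integral_cmult) (auto simp: P_def)
  qed
  also have "card (arc_edge G ` set p) = length p"
    using distinct_card[OF distinct_arc_edges_apath[OF p]] by simp
  also have "ennreal (exp (s * b)) * ennreal ((1 / (1 + s)) ^ length p)
      = ennreal (exp (s * b) * (1 / (1 + s)) ^ length p)"
    using s by (simp add: ennreal_mult')
  finally have "measure P {w \<in> space P. path_passage_time G w p < b} \<le> exp (s * b) * (1 / (1 + s)) ^ length p"
    using s by (simp add: P.emeasure_eq_measure)
  thus ?thesis by (simp add: P_def)
qed

text \<open>
  A path from \<open>i\<close> to \<open>j\<close> is determined by its \<open>l - 1\<close> intermediate vertices.
\<close>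

lemma card_apaths_complete_graph:
  assumes "n > 0" "l > 0"
  shows "card {p. pre_digraph.apath (complete_graph n) i p j \<and> length p = l} \<le> n ^ (l - 1)"
proof -
  interpret strongly_connected_digraph "complete_graph n"
    by (rule strongly_connected_complete_graph) fact
  let ?S = "{p. apath i p j \<and> length p = l}"
  let ?T = "{xs. set xs \<subseteq> {..<n} \<and> length xs = l - 1}"
  have eqI: "p = q" if "cas i p j" "cas i q j" "map snd p = map snd q" for p q i
    using that
  proof (induction p arbitrary: i q)
    case (Cons e p)
    thus ?case by (cases q) (auto simp: prod_eq_iff)
  qed simp
  have last: "snd (last p) = j" if "cas i p j" "p \<noteq> []" for p i
    using that by (induction p arbitrary: i) auto
  have "inj_on (\<lambda>p. butlast (map snd p)) ?S"
  proof (rule inj_onI)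
    fix p q assume p: "p \<in> ?S" and q: "q \<in> ?S" and eq: "butlast (map snd p) = butlast (map snd q)"
    have cas: "cas i p j" "cas i q j" using p q by (auto dest!: awalkI_apath)
    have ne: "p \<noteq> []" "q \<noteq> []" using p q assms by auto
    have "map snd p = butlast (map snd p) @ [snd (last p)]"
      using ne by (metis append_butlast_last_id last_map map_is_Nil_conv)
    moreover have "map snd q = butlast (map snd q) @ [snd (last q)]"
      using ne by (metis append_butlast_last_id last_map map_is_Nil_conv)
    ultimately have "map snd p = map snd q"
      using eq last cas ne by metis
    thus "p = q" using eqI cas by blast
  qed
  moreover have "(\<lambda>p. butlast (map snd p)) ` ?S \<subseteq> ?T"
  proof (rule image_subsetI)
    fix p assume p: "p \<in> ?S"
    hence "set (map snd p) \<subseteq> {..<n}" by (auto dest!: awalkI_apath simp: awalk_def)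
    hence "set (butlast (map snd p)) \<subseteq> {..<n}" by (meson in_set_butlastD subset_iff)
    thus "butlast (map snd p) \<in> ?T" using p by simp
  qed
  moreover have "finite ?T" by (rule finite_lists_length_eq) simp
  ultimately have "card ?S \<le> card ?T" by (rule card_inj_on_le)
  thus ?thesis by (simp add: card_lists_length_eq)
qed

text \<open>
  First-moment bound over all paths. Chernoff's bound with \<open>1 + s = n * (1 + \<epsilon>)\<close> beats the at most
  \<open>n ^ (l - 1)\<close> paths of length \<open>l\<close> by a geometric factor \<open>(1 + \<epsilon>) ^ l\<close>, and the sum over \<open>l\<close> is at most
  \<open>1 / \<epsilon>\<close>. For \<open>b = \<beta> * ln n / n\<close> with \<open>\<beta> < 1\<close> the bound is roughly \<open>n powr (\<beta> - 1)\<close>: typical vertices are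
  at distance at least about \<open>ln n / n\<close>.
\<close>

lemma prob_short_path_complete_graph:
  fixes n :: nat and \<epsilon> b :: real
  defines "P \<equiv> exponential_family (edges (complete_graph n))"
  assumes n: "n > 0" and \<epsilon>: "0 < \<epsilon>" and ij: "i \<noteq> j"
  shows "measure P {w \<in> space P. \<exists>p. pre_digraph.apath (complete_graph n) i p j \<and>
             path_passage_time (complete_graph n) w p < b}
         \<le> exp ((real n * (1 + \<epsilon>) - 1) * b) / (real n * \<epsilon>)"
proof -
  interpret strongly_connected_digraph "complete_graph n"
    by (rule strongly_connected_complete_graph) fact
  interpret P: prob_space P
    unfolding P_def by (rule prob_space_exponential_family)
  define s where "s = real n * (1 + \<epsilon>) - 1"
  define y where "y = 1 / (1 + \<epsilon>)"
  define S where "S = {p. apath i p j}"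
  have "1 * 1 \<le> real n * (1 + \<epsilon>)"
    using n \<epsilon> by (intro mult_mono) auto
  hence s: "0 \<le> s" by (simp add: s_def)
  have fin: "finite S" unfolding S_def by (rule apaths_finite)
  have len: "length p \<in> {1..n}" if "p \<in> S" for p
    using that ij length_apath[of i p j] by (cases p) (auto simp: S_def apath_Nil_iff)
  have "measure P {w \<in> space P. \<exists>p. apath i p j \<and> path_passage_time (complete_graph n) w p < b}
      = measure P (\<Union>p\<in>S. {w \<in> space P. path_passage_time (complete_graph n) w p < b})"
    by (rule arg_cong[where f = "measure P"]) (auto simp: S_def)
  also have "\<dots> \<le> (\<Sum>p\<in>S. measure P {w \<in> space P. path_passage_time (complete_graph n) w p < b})"
  proof (rule P.finite_measure_subadditive_finite[OF fin], rule image_subsetI)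
    fix p assume "p \<in> S"
    hence "set p \<subseteq> arcs (complete_graph n)"
      by (simp add: S_def apath_def awalk_def del: complete_graph_simps)
    hence [measurable]: "(\<lambda>w. path_passage_time (complete_graph n) w p) \<in> borel_measurable P"
      unfolding P_def by (rule measurable_path_passage_time)
    show "{w \<in> space P. path_passage_time (complete_graph n) w p < b} \<in> P.events"
      by measurable
  qed
  also have "\<dots> \<le> (\<Sum>p\<in>S. exp (s * b) * (1 / (1 + s)) ^ length p)"
    unfolding P_def S_def by (intro sum_mono prob_path_passage_time_less s) auto
  also have "\<dots> = (\<Sum>l\<in>{1..n}. \<Sum>p\<in>{p \<in> S. length p = l}. exp (s * b) * (1 / (1 + s)) ^ length p)"
    by (rule sum.group [symmetric]) (use fin len in auto)
  also have "\<dots> = (\<Sum>l\<in>{1..n}. real (card {p \<in> S. length p = l}) * (exp (s * b) * (1 / (1 + s)) ^ l))"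
    by (intro sum.cong refl) simp
  also have "\<dots> \<le> (\<Sum>l\<in>{1..n}. real n ^ (l - 1) * (exp (s * b) * (1 / (1 + s)) ^ l))"
    using card_apaths_complete_graph[OF n] s
    by (intro sum_mono mult_right_mono) (auto simp: S_def simp flip: of_nat_power)
  also have "\<dots> = (\<Sum>l\<in>{1..n}. exp (s * b) / real n * y ^ l)"
  proof (intro sum.cong refl)
    fix l assume "l \<in> {1..n}"
    then obtain l' where "l = Suc l'" by (cases l) auto
    moreover have "1 / (1 + s) = y / real n" by (simp add: s_def y_def)
    ultimately show "real n ^ (l - 1) * (exp (s * b) * (1 / (1 + s)) ^ l) = exp (s * b) / real n * y ^ l"
      using n by (simp add: power_divide)
  qed
  also have "\<dots> = exp (s * b) / real n * (\<Sum>l\<in>{1..n}. y ^ l)"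
    by (simp add: sum_distrib_left)
  also have "\<dots> \<le> exp (s * b) / real n * (1 / \<epsilon>)"
  proof (rule mult_left_mono)
    have "(\<Sum>l\<in>{1..m}. y ^ l) = (1 - y ^ m) / \<epsilon>" for m
    proof (induction m)
      case (Suc m)
      have "\<epsilon> * y = 1 - y" using \<epsilon> by (simp add: y_def field_simps)
      hence "y ^ m * (\<epsilon> * y) = y ^ m * (1 - y)" by simp
      hence "y ^ Suc m * \<epsilon> = y ^ m - y ^ Suc m"
        by (simp add: algebra_simps)
      hence "y ^ Suc m = (y ^ m - y ^ Suc m) / \<epsilon>"
        using \<epsilon> by (simp add: eq_divide_eq)
      thus ?case using Suc by (simp add: diff_divide_distrib)
    qed simp
    moreover have "0 \<le> y ^ n" using \<epsilon> by (simp add: y_def)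
    ultimately show "(\<Sum>l\<in>{1..n}. y ^ l) \<le> 1 / \<epsilon>"
      using \<epsilon> by (simp add: divide_right_mono)
  qed simp
  finally show ?thesis
    by (simp add: s_def)
qed

lemma card_edges_at_complete_graph:
  assumes "i < n"
  shows "card {e \<in> edges (complete_graph n). i \<in> e} = n - 1"
proof -
  have "{e \<in> edges (complete_graph n). i \<in> e} = (\<lambda>j. {i, j}) ` ({..<n} - {i})"
    using assms by (fastforce simp: edges_def image_iff)
  also have "card \<dots> = n - 1"
    using assms by (subst card_image) (auto simp: inj_on_def doubleton_eq_iff)
  finally show ?thesis .
qed

lemma card_edges_at_two_complete_graph:
  assumes "i < n" "j < n" "i \<noteq> j"
  shows "card {e \<in> edges (complete_graph n). i \<in> e \<or> j \<in> e} = 2 * n - 3"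
proof -
  interpret strongly_connected_digraph "complete_graph n"
    using assms by (intro strongly_connected_complete_graph) auto
  let ?E = "\<lambda>i. {e \<in> edges (complete_graph n). i \<in> e}"
  have "?E i \<inter> ?E j = {{i, j}}"
    using assms by (fastforce simp: edges_def image_iff)
  hence "card (?E i \<inter> ?E j) = 1" by simp
  moreover have "?E i \<union> ?E j = {e \<in> edges (complete_graph n). i \<in> e \<or> j \<in> e}"
    by auto
  ultimately show ?thesis
    using card_Un_Int[of "?E i" "?E j"] assms card_edges_at_complete_graph[of _ n]
    by (simp add: finite_subset[OF _ finite_edges])
qed

lemma prob_all_ge:
  assumes "finite E" "C \<subseteq> E" "0 \<le> a"
  shows "measure (exponential_family E) {w \<in> space (exponential_family E). \<forall>e\<in>C. a \<le> w e}
           = exp (- a * real (card C))"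
proof -
  interpret P: prob_space "exponential_family E"
    by (rule prob_space_exponential_family)
  have C: "finite C" using assms finite_subset by blast
  have meas: "{w \<in> space (exponential_family E). \<forall>e\<in>C. a \<le> w e} \<in> P.events"
  proof (intro sets.sets_Collect_finite_All C)
    fix e assume "e \<in> C"
    hence [measurable]: "e \<in> E" using assms by auto
    show "{w \<in> space (exponential_family E). a \<le> w e} \<in> P.events" by measurable
  qed
  have "emeasure (exponential_family E) {w \<in> space (exponential_family E). \<forall>e\<in>C. a \<le> w e}
      = (\<integral>\<^sup>+w. indicator {w \<in> space (exponential_family E). \<forall>e\<in>C. a \<le> w e} w \<partial>exponential_family E)"
    using meas by simp
  also have "\<dots> = (\<integral>\<^sup>+w. indicator {w. \<forall>f\<in>C. a \<le> w f} w * 1 \<partial>exponential_family E)"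
    by (intro nn_integral_cong) (auto simp: indicator_def)
  also have "\<dots> = ennreal (exp (- a * real (card C)))"
    using exponential_family_memoryless[OF assms, of "\<lambda>_. 1"] P.emeasure_space_1 by simp
  finally show ?thesis by (simp add: P.emeasure_eq_measure)
qed

text \<open>
  Condition on all edges at \<open>i\<close> and at \<open>j\<close> having passage time at least \<open>a\<close>. By memorylessness their
  excesses over \<open>a\<close> are fresh exponential variables. A path of at least two arcs pays \<open>a\<close> both at its first
  and at its last arc, so it can only beat \<open>2 * a + b\<close> if it beats \<open>b\<close> in the fresh weights. The single
  arc from \<open>i\<close> to \<open>j\<close> pays \<open>a\<close> only once and has to beat \<open>a + b\<close>, which is unlikely for one given edge.
\<close>

lemma prob_isolated_pair_close:
  fixes n :: nat and \<epsilon> a b :: real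
  defines "G \<equiv> complete_graph n"
  defines "P \<equiv> exponential_family (edges G)"
  assumes \<epsilon>: "0 < \<epsilon>" and ab: "0 \<le> a" "0 < a + b" and ij: "i < n" "j < n" "i \<noteq> j"
  shows "measure P {w \<in> space P. (\<forall>e\<in>{e \<in> edges G. i \<in> e \<or> j \<in> e}. a \<le> w e)
             \<and> passage_time G w i j < 2 * a + b}
         \<le> exp (- a * real (2 * n - 3))
            * (exp ((real n * (1 + \<epsilon>) - 1) * b) / (real n * \<epsilon>) + 3 * (a + b))"
proof -
  have n: "n > 0" using ij by auto
  interpret strongly_connected_digraph G
    unfolding G_def by (rule strongly_connected_complete_graph) fact
  interpret P: prob_space P
    unfolding P_def by (rule prob_space_exponential_family)
  define C where "C = {e \<in> edges G. i \<in> e \<or> j \<in> e}"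
  define S1 where "S1 = {w \<in> space P. \<exists>p. apath i p j \<and> path_passage_time G w p < b}"
  define S2 where "S2 = {w \<in> space P. path_passage_time G w [(i, j)] < a + b}"
  define B where "B = {w \<in> space P. (\<forall>e\<in>C. a \<le> w e) \<and> passage_time G w i j < 2 * a + b}"
  have CE: "C \<subseteq> edges G" by (auto simp: C_def)
  have arc: "(i, j) \<in> arcs G" using ij by (simp add: G_def)
  have "tail G (i, j) = i" "head G (i, j) = j" "j \<in> verts G"
    using ij by (simp_all add: G_def)
  hence path_ij: "apath i [(i, j)] j"
    using ij arc by (simp add: apath_Cons_iff apath_Nil_iff)
  have pm: "(\<lambda>w. path_passage_time G w p) \<in> borel_measurable P" if "apath i p j" for p
    unfolding P_def using that by (intro measurable_path_passage_time) (auto dest!: awalkI_apath)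
  have S1: "S1 \<in> P.events"
  proof -
    have "S1 = (\<Union>p\<in>{p. apath i p j}. {w \<in> space P. path_passage_time G w p < b})"
      by (auto simp: S1_def)
    also have "\<dots> \<in> P.events"
      using pm by (intro sets.finite_UN apaths_finite) auto
    finally show ?thesis .
  qed
  have S2: "S2 \<in> P.events"
    unfolding S2_def using pm[OF path_ij] by simp
  have g: "(indicator (S1 \<union> S2) :: _ \<Rightarrow> ennreal) \<in> borel_measurable P"
    using S1 S2 by simp
  have B_imp: "(\<lambda>f. w f - a * indicator C f) \<in> S1 \<union> S2" if w: "w \<in> B" for w
  proof -
    define w' where "w' = (\<lambda>f. w f - a * indicator C f)"
    have w': "w' \<in> space P"
      using w measurable_space[OF measurable_shift_family[OF CE]] by (simp add: B_def w'_def P_def)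
    have le: "w' e \<le> w e" for e using ab by (auto simp: w'_def indicator_def)
    obtain p where p: "apath i p j" "path_passage_time G w p < 2 * a + b"
    proof -
      have "i \<rightarrow>\<^sup>*\<^bsub>G\<^esub> j" using ij by (intro reach) (auto simp: G_def)
      then obtain p where "apath i p j" "passage_time G w i j = path_passage_time G w p"
        using passage_time_attained[of i j w] by blast
      thus ?thesis using that w by (auto simp: B_def)
    qed
    have awalk: "awalk i p j" by (rule awalkI_apath) fact
    obtain e1 q where p_eq: "p = e1 # q"
      using p(1) ij by (cases p) (auto simp: apath_Nil_iff)
    have e1: "e1 \<in> arcs G" "tail G e1 = i"
      using awalk by (auto simp: p_eq awalk_Cons_iff)
    show ?thesis
    proof (cases q rule: rev_cases)
      case Nil
      hence "arc_edge G e1 = {i, j}"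
        using awalk e1 by (simp add: p_eq awalk_Cons_iff awalk_Nil_iff arc_edge_def)
      hence "w {i, j} < 2 * a + b" "{i, j} \<in> C"
        using p(2) p_eq Nil e1 arc_edge_in_edges[OF e1(1)] by (auto simp: C_def)
      hence "w' {i, j} < a + b" by (simp add: w'_def)
      thus ?thesis using w' by (auto simp: S2_def w'_def G_def)
    next
      case (snoc r e2)
      have e2: "e2 \<in> arcs G" "head G e2 = j"
        using awalk by (auto simp: p_eq snoc awalk_Cons_iff awalk_Nil_iff)
      have "arc_edge G e1 \<in> C" "arc_edge G e2 \<in> C"
        using e1 e2 arc_edge_in_edges by (auto simp: C_def arc_edge_def)
      hence "w' (arc_edge G e1) = w (arc_edge G e1) - a" "w' (arc_edge G e2) = w (arc_edge G e2) - a"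
        by (auto simp: w'_def)
      moreover have "path_passage_time G w' r \<le> path_passage_time G w r"
        using awalk le by (intro path_passage_time_mono) (auto simp: p_eq snoc awalk_def)
      ultimately have "path_passage_time G w' p < b"
        using p(2) by (simp add: p_eq snoc)
      thus ?thesis using w' p(1) by (auto simp: S1_def w'_def)
    qed
  qed
  have "emeasure P B \<le> (\<integral>\<^sup>+w. indicator B w \<partial>P)"
    by (cases "B \<in> P.events") (auto simp: emeasure_notin_sets)
  also have "\<dots> \<le> (\<integral>\<^sup>+w. indicator {w. \<forall>f\<in>C. a \<le> w f} w
        * indicator (S1 \<union> S2) (\<lambda>f. w f - a * indicator C f) \<partial>P)"
    using B_imp by (intro nn_integral_mono) (auto simp: indicator_def B_def)
  also have "\<dots> = ennreal (exp (- a * real (card C))) * (\<integral>\<^sup>+w. indicator (S1 \<union> S2) w \<partial>P)"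
    using exponential_family_memoryless[OF finite_edges CE ab(1), of "indicator (S1 \<union> S2)"] g
    by (simp add: P_def)
  also have "(\<integral>\<^sup>+w. indicator (S1 \<union> S2) w \<partial>P) = ennreal (measure P (S1 \<union> S2))"
    using S1 S2 by (simp add: P.emeasure_eq_measure)
  finally have "measure P B \<le> exp (- a * real (card C)) * measure P (S1 \<union> S2)"
    by (simp add: P.emeasure_eq_measure flip: ennreal_mult')
  also have "card C = 2 * n - 3"
    unfolding C_def G_def using ij by (rule card_edges_at_two_complete_graph)
  also have "measure P (S1 \<union> S2) \<le> measure P S1 + measure P S2"
    using S1 S2 by (rule measure_Un_le)
  also have "measure P S1 \<le> exp ((real n * (1 + \<epsilon>) - 1) * b) / (real n * \<epsilon>)"
    unfolding S1_def P_def G_def by (rule prob_short_path_complete_graph) fact+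
  also have "measure P S2 \<le> 3 * (a + b)"
  proof -
    \<comment> \<open>The value of \<open>s\<close> that makes the exponential factor in Chernoff's bound equal to \<open>exp 1\<close>.\<close>
    define s where "s = 1 / (a + b)"
    have "measure P S2 \<le> exp (s * (a + b)) * (1 / (1 + s)) ^ length [(i, j)]"
      unfolding S2_def P_def using ab by (intro prob_path_passage_time_less[OF path_ij]) (auto simp: s_def)
    also have "\<dots> = exp 1 * ((a + b) / (1 + (a + b)))"
      using ab by (simp add: s_def field_simps)
    also have "\<dots> \<le> 3 * (a + b)"
    proof (rule mult_mono)
      have "(a + b) / (1 + (a + b)) \<le> (a + b) / 1"
        using ab by (intro divide_left_mono) auto
      thus "(a + b) / (1 + (a + b)) \<le> a + b" by simp
    qed (use ab exp_le in auto)
    finally show ?thesis .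
  qed
  finally show ?thesis by (simp add: B_def C_def mult_left_mono)
qed

text \<open>
  Second-moment method: Chebyshev's inequality for the number of events that occur, whose mean is \<open>\<mu>\<close>.
\<close>

lemma (in prob_space) prob_at_most_one_event:
  fixes A :: "'i \<Rightarrow> 'a set" and I :: "'i set" and p q :: real
  defines "\<mu> \<equiv> real (card I) * p"
  assumes fin: "finite I" and A [measurable]: "\<And>i. i \<in> I \<Longrightarrow> A i \<in> events"
    and p: "\<And>i. i \<in> I \<Longrightarrow> prob (A i) = p"
    and q: "\<And>i j. i \<in> I \<Longrightarrow> j \<in> I \<Longrightarrow> i \<noteq> j \<Longrightarrow> prob (A i \<inter> A j) \<le> q" "0 \<le> q"
    and \<mu>: "1 < \<mu>"
  shows "prob {x \<in> space M. card {i \<in> I. x \<in> A i} \<le> 1}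
           \<le> (\<mu> + (real (card I))\<^sup>2 * q - \<mu>\<^sup>2) / (\<mu> - 1)\<^sup>2"
proof -
  define N where "N x = (\<Sum>i\<in>I. indicator (A i) x :: real)" for x
  have N_card: "N x = real (card {i \<in> I. x \<in> A i})" for x
    using fin by (simp add: N_def indicator_def sum.If_cases Int_def)
  have [measurable]: "N \<in> borel_measurable M"
    unfolding N_def[abs_def] by measurable
  have N_bounded: "\<bar>N x\<bar> \<le> real (card I)" for x
    using fin by (auto simp: N_card intro!: card_mono)
  have int_N: "integrable M N"
    using N_bounded by (intro integrable_const_bound[of _ "real (card I)"]) auto
  have "\<bar>(N x)\<^sup>2\<bar> \<le> (real (card I))\<^sup>2" for x
    using power_mono[OF N_bounded[of x], of 2] by simp
  hence int_N2: "integrable M (\<lambda>x. (N x)\<^sup>2)"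
    by (intro integrable_const_bound[of _ "(real (card I))\<^sup>2"]) auto
  have EN: "expectation N = \<mu>"
    unfolding N_def[abs_def] \<mu>_def using A p by (subst Bochner_Integration.integral_sum) (auto simp: emeasure_eq_measure)
  have "(N x)\<^sup>2 = (\<Sum>i\<in>I. \<Sum>j\<in>I. indicator (A i \<inter> A j) x)" for x
    by (simp add: N_def power2_eq_square sum_product indicator_inter_arith)
  hence "expectation (\<lambda>x. (N x)\<^sup>2) = (\<Sum>i\<in>I. \<Sum>j\<in>I. prob (A i \<inter> A j))"
    using A by (simp add: Bochner_Integration.integral_sum emeasure_eq_measure)
  also have "\<dots> \<le> (\<Sum>i\<in>I. \<Sum>j\<in>I. (if j = i then p else 0) + q)"
    using p q by (intro sum_mono) auto
  also have "\<dots> = \<mu> + (real (card I))\<^sup>2 * q"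
    using fin by (simp add: sum.distrib \<mu>_def power2_eq_square algebra_simps)
  finally have var: "variance N \<le> \<mu> + (real (card I))\<^sup>2 * q - \<mu>\<^sup>2"
    using variance_eq[OF int_N int_N2] by (simp add: EN)
  have "prob {x \<in> space M. card {i \<in> I. x \<in> A i} \<le> 1} \<le> prob {x \<in> space M. \<mu> - 1 \<le> \<bar>N x - expectation N\<bar>}"
  proof (rule finite_measure_mono)
    show "{x \<in> space M. card {i \<in> I. x \<in> A i} \<le> 1} \<subseteq> {x \<in> space M. \<mu> - 1 \<le> \<bar>N x - expectation N\<bar>}"
      using \<mu> by (auto simp: N_card EN)
  qed measurable
  also have "\<dots> \<le> variance N / (\<mu> - 1)\<^sup>2"
    using \<mu> int_N2 by (intro Chebyshev_inequality) auto
  also have "\<dots> \<le> (\<mu> + (real (card I))\<^sup>2 * q - \<mu>\<^sup>2) / (\<mu> - 1)\<^sup>2"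
    using var by (intro divide_right_mono) auto
  finally show ?thesis .
qed

text \<open>
  Call a vertex isolated if all its edges have passage time at least \<open>a\<close>. The flooding time from some
  source is at least \<open>2 * a + b\<close> if there are two isolated vertices and no two isolated vertices are at
  distance less than \<open>2 * a + b\<close>. The first summand bounds the probability of having at most one
  isolated vertex, the second one the expected number of ordered pairs of isolated vertices that are
  too close. The mean number of isolated vertices is \<open>\<nu>\<close>, and \<open>exp a\<close> accounts for the edge that
  two vertices share.
\<close>

lemma prob_max_flooding_time_complete_graph_less:
  fixes n :: nat and \<epsilon> a b :: real
  defines "G \<equiv> complete_graph n"
  defines "P \<equiv> exponential_family (edges G)"
  defines "\<nu> \<equiv> real n * exp (- a * (real n - 1))"
  assumes n: "n \<ge> 2" and \<epsilon>: "0 < \<epsilon>" and ab: "0 \<le> a" "0 < a + b" and \<nu>: "1 < \<nu>"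
  shows "measure P {w \<in> space P. max_flooding_time G w < 2 * a + b}
    \<le> (\<nu> + \<nu>\<^sup>2 * (exp a - 1)) / (\<nu> - 1)\<^sup>2
      + (real n)\<^sup>2 * (exp (- a * (2 * real n - 3))
            * (exp ((real n * (1 + \<epsilon>) - 1) * b) / (real n * \<epsilon>) + 3 * (a + b)))"
proof -
  interpret strongly_connected_digraph G
    unfolding G_def using n by (intro strongly_connected_complete_graph) auto
  interpret P: prob_space P
    unfolding P_def by (rule prob_space_exponential_family)
  define q where "q = exp (- a * (2 * real n - 3))"
  define K where "K = q * (exp ((real n * (1 + \<epsilon>) - 1) * b) / (real n * \<epsilon>) + 3 * (a + b))"
  define A where "A i = {w \<in> space P. \<forall>e\<in>{e \<in> edges G. i \<in> e}. a \<le> w e}" for i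
  define B where "B = (\<lambda>(i, j). {w \<in> space P. (\<forall>e\<in>{e \<in> edges G. i \<in> e \<or> j \<in> e}. a \<le> w e)
             \<and> passage_time G w i j < 2 * a + b})"
  define J where "J = {(i, j). i < n \<and> j < n \<and> i \<noteq> j}"
  define few where "few = {w \<in> space P. card {i \<in> {..<n}. w \<in> A i} \<le> 1}"
  have J: "finite J" "card J \<le> n ^ 2"
  proof -
    have "J \<subseteq> {..<n} \<times> {..<n}" by (auto simp: J_def)
    thus "finite J" "card J \<le> n ^ 2"
      using card_mono[of "{..<n} \<times> {..<n}" J]
      by (auto intro: finite_subset simp: card_cartesian_product power2_eq_square)
  qed
  have all_ge: "{w \<in> space P. \<forall>e\<in>C. a \<le> w e} \<in> P.events" if "C \<subseteq> edges G" for C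
  proof (intro sets.sets_Collect_finite_All)
    show "finite C" using that by (rule finite_subset) simp
    fix e assume "e \<in> C"
    hence [measurable]: "e \<in> edges G" using that by auto
    show "{w \<in> space P. a \<le> w e} \<in> P.events" unfolding P_def by measurable
  qed
  have A: "A i \<in> P.events" for i
    unfolding A_def by (rule all_ge) auto
  have B: "B ij \<in> P.events" if "ij \<in> J" for ij
  proof -
    have [measurable]: "(\<lambda>w. passage_time G w (fst ij) (snd ij)) \<in> borel_measurable P"
      unfolding P_def using that by (intro measurable_passage_time reach) (auto simp: J_def G_def)
    have "B ij = {w \<in> space P. \<forall>e\<in>{e \<in> edges G. fst ij \<in> e \<or> snd ij \<in> e}. a \<le> w e}
        \<inter> {w \<in> space P. passage_time G w (fst ij) (snd ij) < 2 * a + b}"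
      by (auto simp: B_def case_prod_beta)
    also have "\<dots> \<in> P.events"
      by (intro sets.Int all_ge) (auto, measurable)
    finally show ?thesis .
  qed
  have few: "few \<in> P.events"
  proof -
    have "(\<lambda>w. (\<Sum>i<n. indicator (A i) w) :: real) \<in> borel_measurable P"
      using A by (intro borel_measurable_sum borel_measurable_indicator)
    hence "{w \<in> space P. (\<Sum>i<n. indicator (A i) w) \<le> (1 :: real)} \<in> P.events"
      by measurable
    also have "{w \<in> space P. (\<Sum>i<n. indicator (A i) w) \<le> (1 :: real)} = few"
      by (auto simp: few_def indicator_def sum.If_cases Int_def)
    finally show ?thesis .
  qed
  have cover: "{w \<in> space P. max_flooding_time G w < 2 * a + b} \<subseteq> few \<union> (\<Union>ij\<in>J. B ij)"
  proof
    fix w assume w: "w \<in> {w \<in> space P. max_flooding_time G w < 2 * a + b}"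
    show "w \<in> few \<union> (\<Union>ij\<in>J. B ij)"
    proof (cases "w \<in> few")
      case False
      hence "\<not> card {i \<in> {..<n}. w \<in> A i} \<le> Suc 0" using w by (simp add: few_def)
      then obtain i j where ij: "i < n" "j < n" "i \<noteq> j" "w \<in> A i" "w \<in> A j"
        by (auto simp: card_le_Suc0_iff_eq)
      have "passage_time G w i j < 2 * a + b"
        using max_flooding_time_ge[of i j w] ij w by (simp add: G_def)
      hence "w \<in> B (i, j)"
        using ij by (auto simp: B_def A_def)
      thus ?thesis using ij by (auto simp: J_def)
    qed simp
  qed
  have "measure P {w \<in> space P. max_flooding_time G w < 2 * a + b} \<le> measure P (few \<union> (\<Union>ij\<in>J. B ij))"
    using cover few B J by (intro P.finite_measure_mono) auto
  also have "\<dots> \<le> measure P few + measure P (\<Union>ij\<in>J. B ij)"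
    using few B J by (intro measure_Un_le) auto
  also have "measure P (\<Union>ij\<in>J. B ij) \<le> (\<Sum>ij\<in>J. measure P (B ij))"
    using B J by (intro P.finite_measure_subadditive_finite) auto
  also have "\<dots> \<le> (\<Sum>ij\<in>J. K)"
  proof (rule sum_mono)
    fix ij assume "ij \<in> J"
    then obtain i j where ij: "ij = (i, j)" "i < n" "j < n" "i \<noteq> j" by (auto simp: J_def)
    show "measure P (B ij) \<le> K"
      using prob_isolated_pair_close[OF \<epsilon> ab ij(2-4)] n
      by (simp add: ij(1) B_def K_def q_def P_def G_def of_nat_diff)
  qed
  also have "\<dots> \<le> (real n)\<^sup>2 * K"
  proof -
    have "0 \<le> K" using \<epsilon> ab by (simp add: K_def q_def)
    moreover have "real (card J) \<le> (real n)\<^sup>2" using J(2) by (metis of_nat_le_iff of_nat_power)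
    ultimately show ?thesis by (simp add: mult_right_mono)
  qed
  also have "measure P few \<le> (\<nu> + (real n)\<^sup>2 * q - \<nu>\<^sup>2) / (\<nu> - 1)\<^sup>2"
  proof -
    have "P.prob (A i) = exp (- a * (real n - 1))" if "i \<in> {..<n}" for i
      using prob_all_ge[OF finite_edges, of "{e \<in> edges G. i \<in> e}" a] ab that
        card_edges_at_complete_graph[of i n] n
      by (simp add: A_def P_def G_def of_nat_diff)
    moreover have "P.prob (A i \<inter> A j) \<le> q" if "i \<in> {..<n}" "j \<in> {..<n}" "i \<noteq> j" for i j
    proof -
      have "A i \<inter> A j = {w \<in> space P. \<forall>e\<in>{e \<in> edges G. i \<in> e \<or> j \<in> e}. a \<le> w e}"
        by (auto simp: A_def)
      thus ?thesis
        using prob_all_ge[OF finite_edges, of "{e \<in> edges G. i \<in> e \<or> j \<in> e}" a] ab that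
          card_edges_at_two_complete_graph[of i n j] n
        by (simp add: P_def G_def q_def of_nat_diff)
    qed
    ultimately show ?thesis
      using P.prob_at_most_one_event[of "{..<n}" A "exp (- a * (real n - 1))" q] A \<nu>
      by (simp add: few_def \<nu>_def q_def)
  qed
  also have "(real n)\<^sup>2 * q = \<nu>\<^sup>2 * exp a"
  proof -
    have "(exp (- a * (real n - 1)))\<^sup>2 * exp a = q"
      unfolding q_def power2_eq_square exp_add [symmetric] by (simp add: algebra_simps)
    thus ?thesis by (simp add: \<nu>_def power_mult_distrib)
  qed
  also have "\<nu> + \<nu>\<^sup>2 * exp a - \<nu>\<^sup>2 = \<nu> + \<nu>\<^sup>2 * (exp a - 1)"
    by (simp add: algebra_simps)
  finally show ?thesis by (simp add: K_def q_def)
qed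

section \<open>Lower bound on the expectation and asymptotics\<close>

text \<open>
  The joint law of independent variables is the product of their laws, and the flooding time depends
  only on the passage times of the edges of the graph.
\<close>

lemma expectation_max_flooding_time_iid:
  fixes G :: "('v, 'b) pre_digraph" and T :: "'v set \<Rightarrow> 'a \<Rightarrow> real"
  assumes G: "strongly_connected_digraph G" and ne: "edges G \<noteq> {}" and M: "prob_space M"
    and indep: "prob_space.indep_vars M (\<lambda>_. borel) T (edges G)"
    and distr: "\<And>e. e \<in> edges G \<Longrightarrow> distributed M lborel (T e) (exponential_density 1)"
  shows "prob_space.expectation M (\<lambda>\<omega>. max_flooding_time G (\<lambda>e. T e \<omega>))
           = (\<integral>w. max_flooding_time G w \<partial>exponential_family (edges G))"
proof -
  interpret strongly_connected_digraph G by fact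
  interpret prob_space M by fact
  have rv: "random_variable borel (T e)" if "e \<in> edges G" for e
    using distributed_measurable[OF distr[OF that]] by simp
  have T_distr: "distr M borel (T e) = std_exponential" if "e \<in> edges G" for e
    using distributed_distr_eq_density[OF distr[OF that]] by (simp cong: distr_cong)
  define X where "X \<omega> = (\<lambda>e\<in>edges G. T e \<omega>)" for \<omega>
  have X: "X \<in> M \<rightarrow>\<^sub>M PiM (edges G) (\<lambda>_. borel)"
    unfolding X_def[abs_def] by (intro measurable_restrict rv)
  have "distr M (PiM (edges G) (\<lambda>_. borel)) X = PiM (edges G) (\<lambda>e. distr M borel (T e))"
    using indep_vars_iff_distr_eq_PiM'[where M' = "\<lambda>_. borel" and X = T, OF ne] rv indep unfolding X_def[abs_def] by simp
  also have "\<dots> = exponential_family (edges G)"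
    by (intro PiM_cong T_distr) auto
  finally have distr_X: "distr M (PiM (edges G) (\<lambda>_. borel)) X = exponential_family (edges G)" .
  have passage: "passage_time G (X \<omega>) u v = passage_time G (\<lambda>e. T e \<omega>) u v" for \<omega> u v
  proof -
    have "path_passage_time G (X \<omega>) p = path_passage_time G (\<lambda>e. T e \<omega>) p"
      if "apath u p v" for p
    proof -
      have "set p \<subseteq> arcs G" using that by (auto dest!: awalkI_apath)
      thus ?thesis by (induction p) (auto simp: X_def)
    qed
    thus ?thesis unfolding passage_time_def by (intro arg_cong[where f = Min] image_cong) auto
  qed
  have "(\<integral>w. max_flooding_time G w \<partial>exponential_family (edges G))
      = (\<integral>\<omega>. max_flooding_time G (X \<omega>) \<partial>M)"
    unfolding distr_X [symmetric]
    using measurable_max_flooding_time X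
    by (subst integral_distr) (auto simp: measurable_exponential_family)
  also have "(\<lambda>\<omega>. max_flooding_time G (X \<omega>)) = (\<lambda>\<omega>. max_flooding_time G (\<lambda>e. T e \<omega>))"
    by (simp add: max_flooding_time_def flooding_time_from_def passage)
  finally show ?thesis by simp
qed

lemma max_flooding_time_complete_graph_expectation_ge:
  fixes n :: nat and \<epsilon> a b :: real
  defines "G \<equiv> complete_graph n"
  defines "P \<equiv> exponential_family (edges G)"
  defines "\<nu> \<equiv> real n * exp (- a * (real n - 1))"
  assumes n: "n \<ge> 2" and \<epsilon>: "0 < \<epsilon>" and ab: "0 \<le> a" "0 \<le> b" "0 < a + b" and \<nu>: "1 < \<nu>"
  shows "(2 * a + b) * (1 - (\<nu> + \<nu>\<^sup>2 * (exp a - 1)) / (\<nu> - 1)\<^sup>2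
      - (real n)\<^sup>2 * (exp (- a * (2 * real n - 3))
            * (exp ((real n * (1 + \<epsilon>) - 1) * b) / (real n * \<epsilon>) + 3 * (a + b))))
      \<le> (\<integral>w. max_flooding_time G w \<partial>P)"
proof -
  interpret strongly_connected_digraph G
    unfolding G_def using n by (intro strongly_connected_complete_graph) auto
  interpret P: prob_space P
    unfolding P_def by (rule prob_space_exponential_family)
  let ?D = "max_flooding_time G"
  have meas [measurable]: "?D \<in> borel_measurable P"
    unfolding P_def using measurable_max_flooding_time by simp
  have int: "integrable P ?D"
    unfolding P_def G_def using n
    by (intro max_flooding_time_complete_graph_expectation_le(1)[where \<delta> = "1 / 2"]) auto
  have nonneg: "AE w in P. 0 \<le> ?D w"
    unfolding P_def
    by (rule AE_mp[OF AE_exponential_family_nonneg[OF finite_edges]])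
       (auto intro!: AE_I2 max_flooding_time_nonneg)
  define S where "S = {w \<in> space P. ?D w < 2 * a + b}"
  have S: "S \<in> P.events" unfolding S_def by measurable
  have "(2 * a + b) * (1 - measure P S) = (2 * a + b) * measure P (space P - S)"
    using P.prob_compl[OF S] by simp
  also have "\<dots> = (\<integral>w. (2 * a + b) * indicator (space P - S) w \<partial>P)"
    using S by (simp add: P.emeasure_eq_measure)
  also have "\<dots> \<le> (\<integral>w. ?D w \<partial>P)"
  proof (rule integral_mono_AE)
    show "integrable P (\<lambda>w. (2 * a + b) * indicator (space P - S) w)"
      using S by (intro integrable_mult_right) (auto simp: P.emeasure_eq_measure)
    show "AE w in P. (2 * a + b) * indicator (space P - S) w \<le> ?D w"
      using nonneg by eventually_elim (auto simp: S_def indicator_def)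
  qed (rule int)
  finally have *: "(2 * a + b) * (1 - measure P S) \<le> (\<integral>w. ?D w \<partial>P)" .
  have "measure P S \<le> (\<nu> + \<nu>\<^sup>2 * (exp a - 1)) / (\<nu> - 1)\<^sup>2
      + (real n)\<^sup>2 * (exp (- a * (2 * real n - 3))
            * (exp ((real n * (1 + \<epsilon>) - 1) * b) / (real n * \<epsilon>) + 3 * (a + b)))"
    unfolding S_def P_def G_def \<nu>_def
    by (rule prob_max_flooding_time_complete_graph_less) (use n \<epsilon> ab \<nu> in \<open>auto simp: \<nu>_def\<close>)
  hence "(2 * a + b) * (1 - (\<nu> + \<nu>\<^sup>2 * (exp a - 1)) / (\<nu> - 1)\<^sup>2
      - (real n)\<^sup>2 * (exp (- a * (2 * real n - 3))
            * (exp ((real n * (1 + \<epsilon>) - 1) * b) / (real n * \<epsilon>) + 3 * (a + b))))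
      \<le> (2 * a + b) * (1 - measure P S)"
    using ab by (intro mult_left_mono) auto
  with * show ?thesis by linarith
qed

text \<open>
  The levels of the lower bound as functions of the number of vertices. With
  \<open>\<epsilon> = 1 / sqrt (ln n)\<close>, isolation means at least \<open>a = (1 - \<epsilon>) * ln n / n\<close> at every edge, and the distance
  to be bridged in between is \<open>b = (1 - 4 * \<epsilon>) * ln n / n\<close>. Then there are about \<open>n powr \<epsilon>\<close> isolated
  vertices, hence \<open>n powr (2 * \<epsilon>)\<close> pairs of them, and a given pair is close with probability about
  \<open>n powr (- 3 * \<epsilon>)\<close>. The slack tends to 0, but slowly enough that \<open>n powr \<epsilon> = exp (sqrt (ln n))\<close> is
  unbounded and dominates \<open>1 / \<epsilon>\<close>. The same slack serves as the parameter \<open>\<delta>\<close> of the upper bound.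
\<close>

definition slack :: "real \<Rightarrow> real" where
  "slack x = 1 / sqrt (ln x)"

definition isolation :: "real \<Rightarrow> real" where
  "isolation x = (1 - slack x) * ln x / x"

definition typical_distance :: "real \<Rightarrow> real" where
  "typical_distance x = (1 - 4 * slack x) * ln x / x"

definition mean_isolated :: "real \<Rightarrow> real" where
  "mean_isolated x = x * exp (- isolation x * (x - 1))"

lemmas parameter_defs = mean_isolated_def isolation_def typical_distance_def slack_def

lemma upper_bound_asymptotics:
  "((\<lambda>x. (3 * ln x + 2 + 8 / slack x) / ((1 - slack x) * (x - 1)) / (3 / x * ln x)) \<longlongrightarrow> 1) at_top"
  unfolding parameter_defs by real_asymp

lemma mean_isolated_at_top: "filterlim mean_isolated at_top at_top"
  unfolding parameter_defs[abs_def] by real_asymp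

lemma lower_bound_main_term_asymptotics:
  "((\<lambda>x. (2 * isolation x + typical_distance x) / (3 / x * ln x)) \<longlongrightarrow> 1) at_top"
  unfolding parameter_defs by real_asymp

lemma few_isolated_asymptotics:
  "((\<lambda>x. (mean_isolated x + (mean_isolated x)\<^sup>2 * (exp (isolation x) - 1)) / (mean_isolated x - 1)\<^sup>2) \<longlongrightarrow> 0) at_top"
proof -
  have "((\<lambda>m :: real. m / (m - 1)\<^sup>2) \<longlongrightarrow> 0) at_top" "((\<lambda>m :: real. m\<^sup>2 / (m - 1)\<^sup>2) \<longlongrightarrow> 1) at_top"
    by real_asymp+
  note this[THEN filterlim_compose, OF mean_isolated_at_top]
  moreover have "((\<lambda>x. exp (isolation x) - 1) \<longlongrightarrow> 0) at_top"
    unfolding parameter_defs by real_asymp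
  ultimately have "((\<lambda>x. mean_isolated x / (mean_isolated x - 1)\<^sup>2
      + (mean_isolated x)\<^sup>2 / (mean_isolated x - 1)\<^sup>2 * (exp (isolation x) - 1)) \<longlongrightarrow> 0 + 1 * 0) at_top"
    by (intro tendsto_intros)
  thus ?thesis by (simp add: add_divide_distrib)
qed

lemma close_pairs_asymptotics:
  "((\<lambda>x. x\<^sup>2 * (exp (- isolation x * (2 * x - 3))
       * (exp ((x * (1 + slack x) - 1) * typical_distance x) / (x * slack x)
          + 3 * (isolation x + typical_distance x)))) \<longlongrightarrow> 0) at_top"
proof -
  have "((\<lambda>x. x\<^sup>2 * exp (- isolation x * (2 * x - 3))
      * (exp ((x * (1 + slack x) - 1) * typical_distance x) / (x * slack x))) \<longlongrightarrow> 0) at_top"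
    unfolding parameter_defs by real_asymp
  moreover have "((\<lambda>x. x\<^sup>2 * exp (- isolation x * (2 * x - 3))
      * (3 * (isolation x + typical_distance x))) \<longlongrightarrow> 0) at_top"
    unfolding parameter_defs by real_asymp
  ultimately show ?thesis
    using tendsto_add by (fastforce simp: distrib_left mult.assoc)
qed

lemma eventually_parameters_admissible:
  "eventually (\<lambda>x. x \<ge> 2 \<and> 0 < slack x \<and> slack x < 1 \<and> 0 \<le> isolation x \<and> 0 \<le> typical_distance x
     \<and> 0 < isolation x + typical_distance x \<and> 1 < mean_isolated x) at_top"
proof (intro eventually_conj)
  show "eventually (\<lambda>x. 1 < mean_isolated x) at_top"
    using mean_isolated_at_top by (simp add: filterlim_at_top_dense)
qed (unfold parameter_defs, real_asymp+)

lemma expectation_max_flooding_time_complete_graph: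
  "(\<lambda>n. \<integral>w. max_flooding_time (complete_graph n) w \<partial>exponential_family (edges (complete_graph n)))
     \<sim>[at_top] (\<lambda>n. 3 / real n * ln (real n))"
proof -
  define E where "E n = (\<integral>w. max_flooding_time (complete_graph n) w \<partial>exponential_family (edges (complete_graph n)))" for n
  define U where "U x = (3 * ln x + 2 + 8 / slack x) / ((1 - slack x) * (x - 1))" for x
  define F1 where "F1 x = (mean_isolated x + (mean_isolated x)\<^sup>2 * (exp (isolation x) - 1)) / (mean_isolated x - 1)\<^sup>2" for x
  define F2 where "F2 x = x\<^sup>2 * (exp (- isolation x * (2 * x - 3))
       * (exp ((x * (1 + slack x) - 1) * typical_distance x) / (x * slack x)
          + 3 * (isolation x + typical_distance x)))" for x
  define L where "L x = (2 * isolation x + typical_distance x) * (1 - F1 x - F2 x)" for x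
  define R where "R x = 3 / x * ln x" for x :: real
  have U: "((\<lambda>x. U x / R x) \<longlongrightarrow> 1) at_top"
    unfolding U_def R_def by (rule upper_bound_asymptotics)
  have "((\<lambda>x. (2 * isolation x + typical_distance x) / R x * (1 - F1 x - F2 x)) \<longlongrightarrow> 1 * (1 - 0 - 0)) at_top"
    unfolding R_def F1_def F2_def
    by (intro tendsto_mult tendsto_diff tendsto_const lower_bound_main_term_asymptotics
          few_isolated_asymptotics close_pairs_asymptotics)
  hence L: "((\<lambda>x. L x / R x) \<longlongrightarrow> 1) at_top"
    by (simp add: L_def)
  have ev: "eventually (\<lambda>n. L (real n) \<le> E n \<and> E n \<le> U (real n)) at_top"
    using eventually_compose_filterlim[OF eventually_parameters_admissible filterlim_real_sequentially]
  proof eventually_elim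
    case (elim n)
    hence n: "n \<ge> 2" by simp
    have "E n \<le> U (real n)"
      unfolding E_def U_def using elim n
      by (intro max_flooding_time_complete_graph_expectation_le(2)) auto
    moreover have "L (real n) \<le> E n"
      unfolding E_def L_def F1_def F2_def mean_isolated_def using elim n
      by (intro max_flooding_time_complete_graph_expectation_ge) (auto simp: mean_isolated_def)
    ultimately show ?case by simp
  qed
  have R: "eventually (\<lambda>n. 0 < R (real n)) at_top"
    unfolding R_def by real_asymp
  have "((\<lambda>n. E n / R (real n)) \<longlongrightarrow> 1) at_top"
  proof (rule tendsto_sandwich)
    show "((\<lambda>n. L (real n) / R (real n)) \<longlongrightarrow> 1) at_top"
      by (rule filterlim_compose[OF L filterlim_real_sequentially])
    show "((\<lambda>n. U (real n) / R (real n)) \<longlongrightarrow> 1) at_top"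
      by (rule filterlim_compose[OF U filterlim_real_sequentially])
    show "eventually (\<lambda>n. L (real n) / R (real n) \<le> E n / R (real n)) at_top"
      using ev R by eventually_elim (auto intro!: divide_right_mono)
    show "eventually (\<lambda>n. E n / R (real n) \<le> U (real n) / R (real n)) at_top"
      using ev R by eventually_elim (auto intro!: divide_right_mono)
  qed
  moreover have "eventually (\<lambda>n. R (real n) \<noteq> 0) at_top"
    using R by eventually_elim auto
  ultimately show ?thesis
    unfolding E_def R_def by (intro asymp_equivI'_const[where c = 1, simplified] | rule asymp_equivI')
qed

theorem corollary1p9:
  fixes M :: "nat \<Rightarrow> 'a measure"
    and T :: "nat \<Rightarrow> nat set \<Rightarrow> 'a \<Rightarrow> real"
  assumes "\<And>n. prob_space (M n)"
    and "\<And>n. prob_space.indep_vars (M n) (\<lambda>_. borel) (T n) (edges (complete_graph n))"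
    and "\<And>n e. e \<in> edges (complete_graph n) \<Longrightarrow>
           distributed (M n) lborel (T n e) (exponential_density 1)"
  shows "(\<lambda>n. prob_space.expectation (M n)
                (\<lambda>\<omega>. max_flooding_time (complete_graph n) (\<lambda>e. T n e \<omega>)))
         \<sim>[at_top] (\<lambda>n. 3 / real n * ln (real n))"
proof -
  have "prob_space.expectation (M n) (\<lambda>\<omega>. max_flooding_time (complete_graph n) (\<lambda>e. T n e \<omega>))
      = (\<integral>w. max_flooding_time (complete_graph n) w \<partial>exponential_family (edges (complete_graph n)))"
    if n: "n \<ge> 2" for n
  proof (rule expectation_max_flooding_time_iid)
    show "strongly_connected_digraph (complete_graph n)"
      using n by (intro strongly_connected_complete_graph) simp
    have "(0, 1) \<in> arcs (complete_graph n)" using n by simp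
    thus "edges (complete_graph n) \<noteq> {}" by (auto simp: edges_def simp del: complete_graph_simps)
  qed (use assms in auto)
  hence "eventually (\<lambda>n. (\<integral>w. max_flooding_time (complete_graph n) w \<partial>exponential_family (edges (complete_graph n)))
      = prob_space.expectation (M n) (\<lambda>\<omega>. max_flooding_time (complete_graph n) (\<lambda>e. T n e \<omega>))) at_top"
    by (intro eventually_at_top_linorderI[of 2]) simp
  from asymp_equiv_cong[OF this, of "\<lambda>n. 3 / real n * ln (real n)" "\<lambda>n. 3 / real n * ln (real n)"]
    expectation_max_flooding_time_complete_graph
  show ?thesis by simp
qed

end
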